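(* Let $0<p<1$ and $q=1-p$. Let $\omega_0,\omega_1,\dots$ be independent and identically distributed random variables on a probability space $(\Omega,\mathcal{F},\mathrm{P})$ with $\mathrm{P}(\omega_n=1)=p=1-\mathrm{P}(\omega_n=-1)$, and let $f$ be the random function $$f(x)=\sum_{n=0}^\infty\frac{\omega_n}{2^n}\phi(2^n x),\qquad 0\le x\le 1.$$ (i) The zero set $L_f(0)$ is finite with probability $$\mathrm{P}(\#L_f(0)<\infty)=1-\min\{p/q,\,q/p\},$$ and given that $L_f(0)$ is infinite, $\dim_H L_f(0)>0$ almost surely, for each $p\in(0,1)$. (ii) If $p=1/2$, then $\dim_H L_f(0)\le d_0$ almost surely, where $$d_0:=\frac{\log\big((1+\sqrt5)/2\big)}{\log 4}.$$
   Context: $\phi(x)=\operatorname{dist}(x,\mathbb{Z})$ is the distance from $x\in\mathbb{R}$ to the nearest integer. $L_f(0)=\{x\in[0,1]: f(x)=0\}$, and $\#$ denotes cardinality. $\dim_H$ denotes Hausdorff dimension. *)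

theory Defs
  imports "HOL-Probability.Probability"
begin

definition phi :: "real \<Rightarrow> real" where
  "phi x = infdist x \<int>"

definition flexible_takagi :: "(nat \<Rightarrow> real) \<Rightarrow> real \<Rightarrow> real" where
  "flexible_takagi r x = (\<Sum>n. r n / 2 ^ n * phi (2 ^ n * x))"

definition level_set :: "(real \<Rightarrow> real) \<Rightarrow> real \<Rightarrow> real set" where
  "level_set f y = {x \<in> {0..1}. f x = y}"

(* (diam U)^s, with (diam {})^s = 0 and 0^0 = 1 on nonempty sets (so that the case s = 0 gives
   counting measure). The explicit case s = 0 is needed because 0 powr 0 = 0.
   Only meaningful for bounded U. *)
definition diam_pow :: "real \<Rightarrow> 'a::metric_space set \<Rightarrow> ennreal" where
  "diam_pow s U = (if U = {} then 0 else if s = 0 then 1 else ennreal (diameter U powr s))"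

(* Boundedness is required explicitly: diameter is real-valued and unspecified on
   unbounded sets. The value is top if A has no countable cover of this kind. *)
definition hausdorff_premeasure :: "real \<Rightarrow> real \<Rightarrow> 'a::metric_space set \<Rightarrow> ennreal" where
  "hausdorff_premeasure s \<delta> A =
    (INF U \<in> {U :: nat \<Rightarrow> 'a set.
        A \<subseteq> (\<Union>i. U i) \<and> (\<forall>i. bounded (U i) \<and> diameter (U i) \<le> \<delta>)}.
      \<Sum>i. diam_pow s (U i))"

definition hausdorff_measure :: "real \<Rightarrow> 'a::metric_space set \<Rightarrow> ennreal" where
  "hausdorff_measure s A = (SUP \<delta> \<in> {0<..}. hausdorff_premeasure s \<delta> A)"

definition hausdorff_dim :: "'a::metric_space set \<Rightarrow> ennreal" where
  "hausdorff_dim A = (INF s \<in> {s. 0 \<le> s \<and> hausdorff_measure s A = 0}. ennreal s)"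

end

theory Submission
  imports Defs
begin

text \<open>
  Fix a sequence of signs and let \<open>f\<close> be the corresponding function. On a dyadic segment of
  level \<open>n\<close>, magnified by the factor \<open>2 ^ n\<close>, \<open>f\<close> is an affine function with integer end values
  plus a function of the same kind for the remaining signs (\<open>takagi_in_segment\<close>), and the latter
  has modulus less than 1. The two end values never have opposite signs. Hence all zeros lie in
  live segments, those with at least one end value 0; let \<open>s\<close> be the other end value. When a live
  segment is bisected and the next sign is \<open>e\<close>, the half at the zero end is live with value
  \<open>s + e\<close>. The other half is live only in two cases: if \<open>s = 0\<close>, with value \<open>e\<close> again, and if
  \<open>s + e = 0\<close>, with value \<open>2 * s\<close>. In the leftmost segment, \<open>s\<close> is the random walk \<open>S\<close> with the
  given signs as steps.

  If \<open>S\<close> is never positive and finally negative, all values \<open>s\<close> are finally negative, since they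
  stay below \<open>S\<close>. Then no new zeros arise on the grid, and \<open>f\<close> has finitely many zeros
  (\<open>finite_zeros_if_walk_stays_below\<close>). If \<open>S\<close> takes both signs, then at some level there are live
  segments with values 1 and -1. Such a pair has descendants forming such a pair after any four
  further signs, and two disjoint pairs of descendants after the signs \<open>- + + -\<close>
  (\<open>opposite_pair_children\<close>). Almost surely that block has positive frequency, so the zero set
  contains a Cantor set of positive dimension (\<open>hausdorff_dim_zeros_pos\<close>). Up to a null set the
  zero set is therefore finite if and only if \<open>S\<close> is one-sided, and the probability of this
  follows from gambler's ruin (\<open>reach_prob_limit\<close>).

  For the upper bound with \<open>p = 1/2\<close>, note that zeros which are not dyadic rationals lie in
  infinitely many live segments with \<open>s = 1\<close> or \<open>s = - 1\<close>. Suitable weights, decaying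
  geometrically in \<open>\<bar>s\<bar>\<close>, make the mean total weight of the live segments grow by the square
  root of the golden ratio per level (\<open>bernoulli_mean_word_weight\<close>), which is \<open>2 powr d\<close> for the
  exponent \<open>d\<close> in the claim. The natural cover by these segments gives the bound
  (\<open>hausdorff_dim_zeros_le\<close>).
\<close>

section \<open>Signed Takagi functions\<close>

lemma Ints_nonempty: "(\<int> :: real set) \<noteq> {}"
  by (metis Ints_0 empty_iff)

lemma phi_lower: "0 \<le> phi x"
  unfolding phi_def by (rule infdist_nonneg)

lemma phi_periodic: "phi (x + of_int k) = phi x"
proof -
  have le: "phi (y + of_int j) \<le> phi y" for y j
  proof -
    have "infdist (y + of_int j) \<int> \<le> dist y z" if "z \<in> \<int>" for z
      using infdist_le2[of "z + of_int j" \<int> "y + of_int j" "dist y z"] that by (simp add: dist_norm)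
    then show ?thesis
      unfolding phi_def infdist_notempty[OF Ints_nonempty, of y] by (intro cINF_greatest) auto
  qed
  have "phi x \<le> phi (x + of_int k)"
    using le[of "x + of_int k" "-k"] by simp
  then show ?thesis using le[of x k] by simp
qed

lemma phi_eq_left: assumes "0 \<le> t" "t \<le> 1/2" shows "phi t = t"
proof (rule antisym)
  show "phi t \<le> t"
    unfolding phi_def using infdist_le2[of 0 \<int> t t] assms by simp
  show "t \<le> phi t"
    unfolding phi_def infdist_notempty[OF Ints_nonempty]
  proof (intro cINF_greatest)
    fix z :: real assume "z \<in> \<int>"
    then obtain k where k: "z = of_int k" by (elim Ints_cases)
    have "k \<le> 0 \<or> 1 \<le> k" by linarith
    then show "t \<le> dist t z"
      using assms unfolding k dist_real_def by (auto simp flip: of_int_le_iff)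
  qed (rule Ints_nonempty)
qed

lemma phi_minus: "phi (- x) = phi x"
proof -
  have le: "phi (- y) \<le> phi y" for y
  proof -
    have "infdist (- y) \<int> \<le> dist y z" if "z \<in> \<int>" for z
      using infdist_le2[of "- z" \<int> "- y" "dist y z"] that by (simp add: dist_norm norm_minus_commute)
    then show ?thesis
      unfolding phi_def infdist_notempty[OF Ints_nonempty, of y] by (intro cINF_greatest) auto
  qed
  show ?thesis using le[of x] le[of "- x"] by simp
qed

lemma phi_eq_right: assumes "1/2 \<le> t" "t \<le> 1" shows "phi t = 1 - t"
  using phi_eq_left[of "1 - t"] phi_periodic[of "- t" 1] phi_minus[of t] assms by simp

lemma phi_upper: "phi x \<le> 1/2"
proof -
  have "phi x = phi (frac x)" using phi_periodic[of "frac x" "\<lfloor>x\<rfloor>"] by (simp add: frac_def)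
  moreover have "0 \<le> frac x" "frac x < 1" by (auto simp: frac_lt_1)
  ultimately show ?thesis
    using phi_eq_left[of "frac x"] phi_eq_right[of "frac x"] by (cases "frac x \<le> 1/2") auto
qed

text \<open>
  The signs are carried by Booleans, so that every sequence of Booleans is a legitimate
  sequence of signs; in the random setting True stands for the event that the variable equals 1.
\<close>
definition sg :: "bool \<Rightarrow> int" where
  "sg c = (if c then 1 else - 1)"

lemma sg_simps [simp]: "sg True = 1" "sg False = - 1"
  by (auto simp: sg_def)

lemma sg_Not [simp]: "sg (\<not> c) = - sg c"
  by (simp add: sg_def)

definition takagi :: "(nat \<Rightarrow> bool) \<Rightarrow> real \<Rightarrow> real" where
  "takagi b = flexible_takagi (\<lambda>n. of_int (sg (b n)))"

lemma takagi_term_bound: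
  "\<bar>of_int (sg (b n)) / 2 ^ n * phi (2 ^ n * x)\<bar> \<le> (1/2) * (1/2) ^ n"
  using phi_lower[of "2 ^ n * x"] phi_upper[of "2 ^ n * x"]
  by (auto simp: abs_mult sg_def field_simps power_divide)

lemma half_geometric: "(\<lambda>n. (1/2) * (1/2::real) ^ n) sums 1"
  using sums_mult[OF geometric_sums[of "1/2::real"], of "1/2"] by simp

lemma summable_abs_takagi: "summable (\<lambda>n. \<bar>of_int (sg (b n)) / 2 ^ n * phi (2 ^ n * x)\<bar>)"
  by (rule summable_comparison_test'[OF sums_summable[OF half_geometric]])
    (metis takagi_term_bound abs_idempotent real_norm_def)

lemma summable_takagi: "summable (\<lambda>n. of_int (sg (b n)) / 2 ^ n * phi (2 ^ n * x))"
  by (rule summable_rabs_cancel[OF summable_abs_takagi])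

lemma abs_takagi_le_1: "\<bar>takagi b x\<bar> \<le> 1"
proof -
  have "\<bar>takagi b x\<bar> \<le> (\<Sum>n. \<bar>of_int (sg (b n)) / 2 ^ n * phi (2 ^ n * x)\<bar>)"
    unfolding takagi_def flexible_takagi_def by (rule summable_rabs[OF summable_abs_takagi])
  also have "\<dots> \<le> (\<Sum>n. (1/2) * (1/2) ^ n)"
    by (rule suminf_le[OF takagi_term_bound summable_abs_takagi sums_summable[OF half_geometric]])
  also have "\<dots> = 1" by (rule sums_unique[OF half_geometric, symmetric])
  finally show ?thesis .
qed

lemma takagi_periodic: "takagi b (x + of_nat k) = takagi b x"
proof -
  have "phi (2 ^ n * (x + of_nat k)) = phi (2 ^ n * x)" for n
    using phi_periodic[of "2 ^ n * x" "2 ^ n * int k"] by (simp add: distrib_left)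
  then show ?thesis unfolding takagi_def flexible_takagi_def by simp
qed

lemma takagi_functional_eq:
  "takagi b x = of_int (sg (b 0)) * phi x + takagi (\<lambda>k. b (Suc k)) (2 * x) / 2"
proof -
  let ?g = "\<lambda>n. of_int (sg (b n)) / 2 ^ n * phi (2 ^ n * x)"
  have "takagi b x = ?g 0 + (\<Sum>n. ?g (Suc n))"
    unfolding takagi_def flexible_takagi_def
    using suminf_split_head[OF summable_takagi[of b x]] by simp
  also have "(\<Sum>n. ?g (Suc n))
      = (\<Sum>n. (of_int (sg (b (Suc n))) / 2 ^ n * phi (2 ^ n * (2 * x))) / 2)"
    by (simp add: mult_ac)
  also have "\<dots> = takagi (\<lambda>k. b (Suc k)) (2 * x) / 2"
    unfolding takagi_def flexible_takagi_def by (intro suminf_divide summable_takagi)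
  finally show ?thesis by simp
qed

lemma takagi_0: "takagi b 0 = 0"
proof -
  have "phi 0 = 0" using phi_eq_left[of 0] by simp
  then show ?thesis unfolding takagi_def flexible_takagi_def by simp
qed

text \<open>
  The strict inequality is what makes integer end values useful: a perturbation of modulus less
  than 1 cannot cancel an affine function whose end values are both at least 1. It holds because
  the first term reaches modulus 1/2 only at the midpoint, where all later terms vanish.
\<close>
lemma abs_takagi_less_1:
  assumes "0 \<le> t" "t \<le> 1" shows "\<bar>takagi b t\<bar> < 1"
proof (cases "t = 1/2")
  case True
  have "takagi (\<lambda>k. b (Suc k)) (0 + of_nat 1) = 0" unfolding takagi_periodic by (rule takagi_0)
  then show ?thesis
    unfolding True using takagi_functional_eq[of b "1/2"] phi_eq_left[of "1/2"] by (cases "b 0") simp_all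
next
  case False
  have "phi t < 1/2"
    using False assms phi_eq_left[of t] phi_eq_right[of t] by (cases "t \<le> 1/2") auto
  have "\<bar>takagi b t\<bar> \<le> \<bar>of_int (sg (b 0)) * phi t\<bar> + \<bar>takagi (\<lambda>k. b (Suc k)) (2 * t) / 2\<bar>"
    by (subst takagi_functional_eq) (rule abs_triangle_ineq)
  also have "\<bar>of_int (sg (b 0)) * phi t\<bar> = phi t"
    using phi_lower[of t] by (cases "b 0") auto
  also have "\<bar>takagi (\<lambda>k. b (Suc k)) (2 * t) / 2\<bar> \<le> 1/2"
    using abs_takagi_le_1[of "\<lambda>k. b (Suc k)" "2 * t"] by linarith
  finally show ?thesis using \<open>phi t < 1/2\<close> by linarith
qed

lemma takagi_Not: "takagi (\<lambda>n. \<not> b n) x = - takagi b x"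
proof -
  have "(\<Sum>n. of_int (sg (\<not> b n)) / 2 ^ n * phi (2 ^ n * x)) = (\<Sum>n. - (of_int (sg (b n)) / 2 ^ n * phi (2 ^ n * x)))"
    unfolding sg_Not by (intro suminf_cong) (simp only: of_int_minus minus_divide_left minus_mult_left)
  also have "\<dots> = - (\<Sum>n. of_int (sg (b n)) / 2 ^ n * phi (2 ^ n * x))"
    by (rule suminf_minus[OF summable_takagi])
  finally show ?thesis
  unfolding takagi_def flexible_takagi_def .
qed

section \<open>Integer values on the dyadic grid\<close>

text \<open>
  The value of the function at the grid point \<open>m / 2 ^ n\<close>, magnified by \<open>2 ^ n\<close>
  (see \<open>takagi_in_segment\<close>, at \<open>t = 0\<close>). The recursion shows that it is an integer.
\<close>
fun node :: "(nat \<Rightarrow> bool) \<Rightarrow> nat \<Rightarrow> nat \<Rightarrow> int" where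
  "node b 0 m = 0"
| "node b (Suc n) m = (if even m then 2 * node b n (m div 2)
     else node b n (m div 2) + node b n (m div 2 + 1) + sg (b n))"

lemma node_even [simp]: "node b (Suc n) (2 * m) = 2 * node b n m"
  and node_even_Suc [simp]: "node b (Suc n) (Suc (Suc (2 * m))) = 2 * node b n (Suc m)"
  and node_odd [simp]: "node b (Suc n) (Suc (2 * m)) = node b n m + node b n (Suc m) + sg (b n)"
  by auto

declare node.simps(2) [simp del]

lemma node_Not: "node (\<lambda>n. \<not> b n) n m = - node b n m"
  by (induction n arbitrary: m) (auto simp: node.simps(2))

lemma node_cong: "(\<And>i. i < n \<Longrightarrow> b i = c i) \<Longrightarrow> node b n m = node c n m"
  by (induction n arbitrary: m) (auto simp: node.simps(2))

text \<open>
  Self-similarity: seen through the magnifying glass, the function on a dyadic segment is the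
  affine interpolation of its end values plus the function of the same kind that belongs to the
  remaining signs.
\<close>
lemma takagi_in_segment:
  assumes "0 \<le> t" "t \<le> 1"
  shows "2 ^ n * takagi b ((of_nat m + t) / 2 ^ n)
    = (1 - t) * of_int (node b n m) + t * of_int (node b n (Suc m)) + takagi (\<lambda>k. b (n + k)) t"
  using assms
proof (induction n arbitrary: m t)
  case 0
  then show ?case using takagi_periodic[of b t m] by (simp add: add.commute)
next
  case (Suc n)
  define k where "k = m div 2"
  let ?T = "takagi (\<lambda>j. b (n + j))" and ?T' = "takagi (\<lambda>j. b (Suc n + j))"
  have fe: "2 * ?T x = 2 * of_int (sg (b n)) * phi x + ?T' (2 * x)" for x
    using takagi_functional_eq[of "\<lambda>j. b (n + j)" x] by simp
  show ?case
  proof (cases "even m")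
    case True
    then have m: "m = 2 * k" by (simp add: k_def)
    have "(of_nat m + t) / 2 ^ Suc n = (of_nat k + t/2) / (2 ^ n :: real)"
      by (simp add: m field_simps)
    then have "2 ^ Suc n * takagi b ((of_nat m + t) / 2 ^ Suc n)
      = 2 * ((1 - t/2) * of_int (node b n k) + t/2 * of_int (node b n (Suc k)) + ?T (t/2))"
      using Suc.IH[of "t/2" k] Suc.prems by simp
    also have "\<dots> = (1 - t) * of_int (2 * node b n k)
       + t * of_int (node b n k + node b n (Suc k) + sg (b n)) + ?T' t"
      using fe[of "t/2"] phi_eq_left[of "t/2"] Suc.prems by (simp add: algebra_simps)
    finally show ?thesis by (simp add: m)
  next
    case False
    then have m: "m = 2 * k + 1" by (simp add: k_def)
    have "(of_nat m + t) / 2 ^ Suc n = (of_nat k + (1 + t)/2) / (2 ^ n :: real)"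
      by (simp add: m field_simps)
    then have "2 ^ Suc n * takagi b ((of_nat m + t) / 2 ^ Suc n)
      = 2 * ((1 - (1 + t)/2) * of_int (node b n k) + (1 + t)/2 * of_int (node b n (Suc k)) + ?T ((1 + t)/2))"
      using Suc.IH[of "(1 + t)/2" k] Suc.prems by simp
    also have "\<dots> = (1 - t) * of_int (node b n k + node b n (Suc k) + sg (b n))
       + t * of_int (2 * node b n (Suc k)) + ?T' t"
    proof -
      have "2 * ((1 + t)/2) = t + of_nat 1" "phi ((1 + t)/2) = (1 - t)/2"
        using phi_eq_right[of "(1 + t)/2"] Suc.prems by (simp_all add: field_simps)
      then have "2 * ?T ((1 + t)/2) = (1 - t) * of_int (sg (b n)) + ?T' t"
        using takagi_periodic[of "\<lambda>j. b (Suc n + j)" t 1]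
        by (simp only: fe[of "(1 + t)/2"]) simp
      then show ?thesis by (simp add: field_simps)
    qed
    finally show ?thesis by (simp add: m)
  qed
qed

text \<open>
  The middle value created by a bisection is \<open>u + v \<plusminus> 1\<close>. For integers
  \<open>u\<close>, \<open>v\<close> of the same sign, not both zero, this cannot reach the opposite sign. Hence
  the function never crosses zero within a segment whose end values are both nonzero.
\<close>
lemma node_same_sign:
  "(0 \<le> node b n m \<and> 0 \<le> node b n (Suc m)) \<or> (node b n m \<le> 0 \<and> node b n (Suc m) \<le> 0)"
proof (induction n arbitrary: m)
  case (Suc n)
  define k where "k = m div 2"
  have "sg (b n) = 1 \<or> sg (b n) = - 1" by (simp add: sg_def)
  moreover have "m = 2 * k \<or> m = Suc (2 * k)" by (auto simp: k_def)
  ultimately show ?case using Suc[of k] by fastforce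
qed simp

section \<open>Segments that can contain zeros\<close>

definition seg :: "nat \<Rightarrow> nat \<Rightarrow> real set" where
  "seg n m = {of_nat m / 2 ^ n .. of_nat (Suc m) / 2 ^ n}"

lemma seg_cover:
  assumes "0 \<le> x" "x \<le> 1" shows "\<exists>m < 2 ^ n. x \<in> seg n m"
proof (cases "x = 1")
  case True
  have "(2::nat) ^ n - 1 < 2 ^ n" "real (2 ^ n - 1) = 2 ^ n - 1"
    by (auto simp: of_nat_diff)
  then show ?thesis using True by (intro exI[of _ "2 ^ n - 1"]) (auto simp: seg_def field_simps)
next
  case False
  define m where "m = nat \<lfloor>2 ^ n * x\<rfloor>"
  have m: "real m = of_int \<lfloor>2 ^ n * x\<rfloor>" using assms by (simp add: m_def)
  have "real m \<le> 2 ^ n * x" "2 ^ n * x < real m + 1" unfolding m by linarith+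
  moreover have "2 ^ n * x < 2 ^ n" using assms False by simp
  ultimately have "real m < 2 ^ n" by linarith
  then have "m < 2 ^ n" using of_nat_less_imp_less[of m "2 ^ n", where 'a=real] by simp
  with \<open>real m \<le> 2 ^ n * x\<close> \<open>2 ^ n * x < real m + 1\<close> show ?thesis
    by (intro exI[of _ m]) (auto simp: seg_def field_simps)
qed

lemma seg_param:
  assumes "x \<in> seg n m"
  obtains t where "0 \<le> t" "t \<le> 1" "x = (of_nat m + t) / 2 ^ n"
proof -
  have "0 \<le> 2 ^ n * x - m" "2 ^ n * x - m \<le> 1" using assms by (auto simp: seg_def field_simps)
  then show ?thesis using that[of "2 ^ n * x - m"] by simp
qed

definition live :: "(nat \<Rightarrow> bool) \<Rightarrow> nat \<Rightarrow> nat \<Rightarrow> bool" where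
  "live b n m \<longleftrightarrow> node b n m = 0 \<or> node b n (Suc m) = 0"

text \<open>
  On a live segment one of the two summands vanishes, so this is the end value away from the zero
  end. Up to its sign it is the slope of the affine part.
\<close>
definition outer_value :: "(nat \<Rightarrow> bool) \<Rightarrow> nat \<Rightarrow> nat \<Rightarrow> int" where
  "outer_value b n m = node b n m + node b n (Suc m)"

lemma zero_in_live_segment:
  assumes "takagi b x = 0" "x \<in> seg n m" shows "live b n m"
proof (rule ccontr)
  assume "\<not> live b n m"
  then have nz: "node b n m \<noteq> 0" "node b n (Suc m) \<noteq> 0" by (auto simp: live_def)
  obtain t where t: "0 \<le> t" "t \<le> 1" "x = (of_nat m + t) / 2 ^ n" using seg_param[OF assms(2)] .
  define X :: real where "X = (1 - t) * of_int (node b n m) + t * of_int (node b n (Suc m))"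
  have eq: "X + takagi (\<lambda>k. b (n + k)) t = 0"
    unfolding X_def takagi_in_segment[OF t(1,2), symmetric] t(3)[symmetric] assms(1) by simp
  have small: "\<bar>takagi (\<lambda>k. b (n + k)) t\<bar> < 1" using t by (intro abs_takagi_less_1)
  have *: "1 \<le> (1 - t) * of_int u + t * of_int v" if "1 \<le> u" "1 \<le> v" for u v :: int
  proof -
    have "(1 - t) * 1 + t * 1 \<le> (1 - t) * of_int u + t * of_int v"
      using that t by (intro add_mono mult_left_mono) auto
    then show ?thesis by simp
  qed
  consider "1 \<le> node b n m" "1 \<le> node b n (Suc m)" | "1 \<le> - node b n m" "1 \<le> - node b n (Suc m)"
    using nz node_same_sign[of b n m] by force
  then show False
  proof cases
    case 1
    then have "1 \<le> X" unfolding X_def by (rule *)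
    then show ?thesis using eq small by linarith
  next
    case 2
    have "(1 - t) * of_int (- node b n m) + t * of_int (- node b n (Suc m)) = - X"
      by (simp add: X_def algebra_simps)
    then have "1 \<le> - X" using *[OF 2] by simp
    then show ?thesis using eq small by linarith
  qed
qed

lemma takagi_small_on_live:
  assumes "live b n m" "x \<in> seg n m"
  shows "\<bar>takagi b x\<bar> \<le> (\<bar>of_int (outer_value b n m)\<bar> + 1) / 2 ^ n"
proof -
  obtain t where t: "0 \<le> t" "t \<le> 1" "x = (of_nat m + t) / 2 ^ n" using seg_param[OF assms(2)] .
  have *: "\<bar>u * z\<bar> \<le> \<bar>z\<bar>" if "u \<le> 1" "0 \<le> u" for u z :: real
    using that by (simp add: abs_mult mult_left_le_one_le)
  have "\<bar>(1 - t) * of_int (node b n m) + t * of_int (node b n (Suc m))\<bar> \<le> \<bar>of_int (outer_value b n m) :: real\<bar>"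
    using assms(1) unfolding live_def
  proof
    assume "node b n m = 0"
    then show ?thesis using *[of t "of_int (outer_value b n m)"] t by (simp add: outer_value_def)
  next
    assume "node b n (Suc m) = 0"
    then show ?thesis using *[of "1 - t" "of_int (outer_value b n m)"] t by (simp add: outer_value_def)
  qed
  then have "\<bar>2 ^ n * takagi b x\<bar> \<le> \<bar>of_int (outer_value b n m)\<bar> + 1"
    using abs_takagi_le_1[of "\<lambda>k. b (n + k)" t]
    unfolding t(3) takagi_in_segment[OF t(1,2), of n b m] by linarith
  then have "2 ^ n * \<bar>takagi b x\<bar> \<le> \<bar>of_int (outer_value b n m)\<bar> + 1" by (simp add: abs_mult)
  then show ?thesis using mult_imp_le_div_pos[of "2 ^ n" "\<bar>takagi b x\<bar>"] by (simp add: mult.commute)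
qed

lemma seg_parent: "seg (Suc n) m \<subseteq> seg n (m div 2)"
proof -
  have "2 * (m div 2) \<le> m" "Suc m \<le> 2 * Suc (m div 2)" by simp_all
  then have "real (2 * (m div 2)) / 2 ^ Suc n \<le> real m / 2 ^ Suc n"
    "real (Suc m) / 2 ^ Suc n \<le> real (2 * Suc (m div 2)) / 2 ^ Suc n"
    by (intro divide_right_mono; simp only: of_nat_le_iff; simp)+
  moreover have "real (2 * l) / 2 ^ Suc n = real l / 2 ^ n" for l by simp
  ultimately show ?thesis unfolding seg_def by (intro atLeastatMost_subset_iff[THEN iffD2] disjI2 conjI) metis+
qed

text \<open>
  A zero in a live segment of level \<open>n\<close> is within \<open>(1/2) ^ n\<close> of a grid point at which the
  function vanishes. If, from level \<open>N\<close> on, no bisection near \<open>x\<close> creates a new grid point of this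
  kind, all these grid points already belong to the grid of level \<open>N\<close>. As that grid is finite,
  \<open>x\<close> is one of them.
\<close>
lemma zero_at_old_node:
  assumes x: "0 \<le> x" "x \<le> 1" and zero: "takagi b x = 0"
    and old: "\<And>n m. N \<le> n \<Longrightarrow> x \<in> seg n m \<Longrightarrow> node b (Suc n) (Suc (2 * m)) \<noteq> 0"
  shows "x \<in> (\<lambda>j. real j / 2 ^ N) ` {..2 ^ N}"
proof -
  let ?Z = "(\<lambda>j. real j / 2 ^ N) ` {..2 ^ N}"
  have claim: "\<exists>j. real k / 2 ^ n = real j / 2 ^ N"
    if "N \<le> n" "x \<in> seg n m" "k = m \<or> k = Suc m" "node b n k = 0" for n m k
    using that
  proof (induction n arbitrary: m k rule: dec_induct)
    case (step n)
    define l where "l = m div 2"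
    have xl: "x \<in> seg n l" using step.prems(1) seg_parent[of n m] by (auto simp: l_def)
    have "m = 2 * l \<or> m = Suc (2 * l)" by (auto simp: l_def)
    then have "k = Suc (2 * l) \<or> k = 2 * l \<or> k = 2 * Suc l"
      using step.prems(2) by auto
    moreover have "k \<noteq> Suc (2 * l)"
      using old[OF step.hyps(1) xl] step.prems(3) by auto
    ultimately obtain i where i: "k = 2 * i" "i = l \<or> i = Suc l" by blast
    have "node b n i = 0" using step.prems(3) unfolding i(1) node_even by simp
    from step.IH[OF xl i(2) this] show ?case by (simp add: i(1))
  qed auto
  have "x \<in> closure ?Z"
    unfolding closure_approachable
  proof (intro allI impI)
    fix e :: real assume "0 < e"
    then obtain n0 where n0: "(1/2) ^ n0 < e" using real_arch_pow_inv[of e "1/2"] by auto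
    define n where "n = max n0 N"
    have "(1/2::real) ^ n \<le> (1/2) ^ n0" unfolding n_def by (intro power_decreasing) auto
    from le_less_trans[OF this n0] have n: "(1/2) ^ n < e" "N \<le> n" by (auto simp: n_def)
    obtain m where m: "m < 2 ^ n" "x \<in> seg n m" using seg_cover[OF x] by blast
    obtain k where k: "k = m \<or> k = Suc m" "node b n k = 0"
      using zero_in_live_segment[OF zero m(2)] by (auto simp: live_def)
    obtain j where j: "real k / 2 ^ n = real j / 2 ^ N" using claim[OF n(2) m(2) k] by blast
    have "real k \<le> real (2 ^ n)" using k(1) m(1) unfolding of_nat_le_iff by linarith
    then have "real j / 2 ^ N \<le> 1" unfolding j[symmetric] by simp
    then have "real j \<le> real (2 ^ N)" by (simp add: field_simps)
    then have "j \<le> 2 ^ N" unfolding of_nat_le_iff .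
    moreover have "dist (real j / 2 ^ N) x \<le> (1/2) ^ n"
      using m(2) k(1) unfolding j[symmetric] by (auto simp: seg_def dist_real_def field_simps)
    ultimately show "\<exists>z\<in>?Z. dist z x < e" using n(1) by force
  qed
  then show ?thesis by (simp add: finite_imp_closed closure_closed)
qed

section \<open>One-sided walks and finite zero sets\<close>

text \<open>
  The magnified value at the right end of the leftmost segment of level \<open>n\<close>
  (see \<open>node_at_1\<close>); the left end value there is always 0.
\<close>
definition walk :: "(nat \<Rightarrow> bool) \<Rightarrow> nat \<Rightarrow> int" where
  "walk b n = (\<Sum>k<n. sg (b k))"

lemma walk_0 [simp]: "walk b 0 = 0" and walk_Suc [simp]: "walk b (Suc n) = walk b n + sg (b n)"
  by (auto simp: walk_def)

lemma walk_Not: "walk (\<lambda>n. \<not> b n) n = - walk b n"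
  by (simp add: walk_def sum_negf)

lemma node_at_0 [simp]: "node b n 0 = 0"
proof (induction n)
  case (Suc n) then show ?case using node_even[of b n 0] by simp
qed simp

lemma node_at_1: "node b n (Suc 0) = walk b n"
proof (induction n)
  case (Suc n) then show ?case using node_odd[of b n 0] by simp
qed simp

text \<open>
  Outer values move in parallel with the walk, except that a bisection which creates a zero
  produces a half of outer value \<open>2 * s\<close>. Below a nonpositive walk this only happens with
  \<open>s = - 1\<close> when the walk steps to 0, and the new value \<open>- 2\<close> is then below the walk again.
\<close>
lemma outer_value_le_walk:
  assumes "\<And>n. walk b n \<le> 0"
  shows "live b n m \<Longrightarrow> outer_value b n m \<le> walk b n"
proof (induction n arbitrary: m)
  case (Suc n)
  define k where "k = m div 2"
  have m: "m = 2 * k \<or> m = Suc (2 * k)" by (auto simp: k_def)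
  have s: "sg (b n) = 1 \<or> sg (b n) = - 1" by (simp add: sg_def)
  have IH: "node b n k = 0 \<or> node b n (Suc k) = 0 \<Longrightarrow> node b n k + node b n (Suc k) \<le> walk b n"
    using Suc.IH[of k] by (simp add: live_def outer_value_def)
  have W: "walk b n + sg (b n) \<le> 0" "walk b n \<le> 0" using assms[of "Suc n"] assms[of n] by auto
  show ?case
    using Suc.prems m s IH W node_same_sign[of b n k] unfolding live_def outer_value_def
    by (elim disjE) (simp_all, linarith+)
qed (simp add: outer_value_def)

text \<open>
  Once the walk is negative for good, all outer values are negative for good, so that none of
  them steps from \<open>- 1\<close> to 0 and no new zeros appear on the grid.
\<close>
lemma finite_zeros_if_walk_stays_below:
  assumes le: "\<And>n. walk b n \<le> 0" and less: "\<And>n. N \<le> n \<Longrightarrow> walk b n < 0"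
  shows "finite {x \<in> {0..1}. takagi b x = 0}"
proof (rule finite_subset)
  show "{x \<in> {0..1}. takagi b x = 0} \<subseteq> (\<lambda>j. real j / 2 ^ N) ` {..2 ^ N}"
  proof
    fix x assume "x \<in> {x \<in> {0..1}. takagi b x = 0}"
    then have x: "0 \<le> x" "x \<le> 1" "takagi b x = 0" by auto
    show "x \<in> (\<lambda>j. real j / 2 ^ N) ` {..2 ^ N}"
    proof (rule zero_at_old_node[OF x])
      fix n m assume n: "N \<le> n" "x \<in> seg n m"
      have "outer_value b n m \<le> walk b n"
        by (rule outer_value_le_walk[OF le zero_in_live_segment[OF x(3) n(2)]])
      then show "node b (Suc n) (Suc (2 * m)) \<noteq> 0"
        using less[of "Suc n"] n(1) by (simp add: outer_value_def)
    qed
  qed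
qed simp

section \<open>Pairs of segments with opposite outer values\<close>

definition live_value :: "(nat \<Rightarrow> bool) \<Rightarrow> nat \<Rightarrow> nat \<Rightarrow> int \<Rightarrow> bool" where
  "live_value b n m s \<longleftrightarrow> live b n m \<and> outer_value b n m = s"

text \<open>
  The half that contains the zero end stays live, and its outer value makes the step of the walk.
\<close>
lemma live_value_child:
  assumes "live_value b n m s"
  shows "\<exists>i. i div 2 = m \<and> live_value b (Suc n) i (s + sg (b n))"
proof (cases "node b n m = 0")
  case True
  then show ?thesis using assms
    by (intro exI[of _ "2 * m"]) (auto simp: live_value_def live_def outer_value_def)
next
  case False
  then show ?thesis using assms
    by (intro exI[of _ "Suc (2 * m)"]) (auto simp: live_value_def live_def outer_value_def)
qed

text \<open>
  When the outer value steps to 0, a new zero appears in the middle and both halves are live.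
\<close>
lemma live_value_split:
  assumes "live_value b n m (- sg (b n))"
  shows "\<exists>i j. i div 2 = m \<and> j div 2 = m \<and> live_value b (Suc n) i 0
      \<and> live_value b (Suc n) j (- 2 * sg (b n))"
proof (cases "node b n m = 0")
  case True
  then show ?thesis using assms
    by (intro exI[of _ "2 * m"] exI[of _ "Suc (2 * m)"]) (auto simp: live_value_def live_def outer_value_def)
next
  case False
  then show ?thesis using assms
    by (intro exI[of _ "Suc (2 * m)"] exI[of _ "2 * m"]) (auto simp: live_value_def live_def outer_value_def)
qed

lemma live_value_0_children:
  assumes "live_value b n m 0"
  shows "live_value b (Suc n) (2 * m) (sg (b n))" "live_value b (Suc n) (Suc (2 * m)) (sg (b n))"
  using assms by (auto simp: live_value_def live_def outer_value_def)

text \<open>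
  Outer values 1 and \<open>- 1\<close> together react to every sign: whatever comes next, one of the two
  steps to 0 and splits. This is why pairs of segments, rather than single segments, can be
  propagated without any assumption on the signs.
\<close>
definition opposite_pair :: "(nat \<Rightarrow> bool) \<Rightarrow> nat \<Rightarrow> nat \<times> nat \<Rightarrow> bool" where
  "opposite_pair b n P \<longleftrightarrow> live_value b n (fst P) 1 \<and> live_value b n (snd P) (- 1)"

definition members :: "nat \<times> nat \<Rightarrow> nat set" where
  "members P = {fst P, snd P}"

text \<open>
  The index of the ancestor two or four levels up, as the halving steps produce it.
\<close>
lemma iterated_halves:
  fixes k :: nat
  shows "k div 4 = k div 2 div 2" "k div 16 = k div 2 div 2 div 2 div 2"
    "2 * k div 2 = k" "Suc (2 * k) div 2 = k"
  by simp_all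

text \<open>
  After two equal signs the member that splits has both successors among its descendants:
  its half of value 0 is carried to the opposite sign, and its half of value \<open>\<plusminus> 2\<close> is
  carried back to \<open>\<plusminus> 1\<close>. After two different signs one member makes an excursion
  through 0, the other one through \<open>\<plusminus> 2\<close>.
\<close>
lemma opposite_pair_step2:
  assumes "opposite_pair b n P"
  shows "\<exists>Q. opposite_pair b (Suc (Suc n)) Q \<and> (\<lambda>i. i div 4) ` members Q \<subseteq> members P"
proof -
  obtain i j where P: "P = (i, j)" by (cases P)
  have ij: "live_value b n i 1" "live_value b n j (- 1)"
    using assms by (auto simp: opposite_pair_def P)
  have "\<exists>i' j'. live_value b (Suc (Suc n)) i' 1 \<and> live_value b (Suc (Suc n)) j' (- 1)
     \<and> i' div 4 \<in> {i, j} \<and> j' div 4 \<in> {i, j}"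
  proof (cases "b n"; cases "b (Suc n)")
    assume b: "b n" "b (Suc n)"
    obtain u v where uv: "u div 2 = j" "v div 2 = j" "live_value b (Suc n) u 0" "live_value b (Suc n) v (- 2)"
      using live_value_split[of b n j] ij(2) b by auto
    obtain v' where v': "v' div 2 = v" "live_value b (Suc (Suc n)) v' (- 1)"
      using live_value_child[OF uv(4)] b by auto
    have "live_value b (Suc (Suc n)) (2 * u) 1"
      using live_value_0_children(1)[OF uv(3)] b by simp
    then show ?thesis using v'(2)
      by (intro exI[of _ "2 * u"] exI[of _ v']) (simp only: iterated_halves uv(1,2) v'(1) insertI1 insertI2 singletonI simp_thms)
  next
    assume b: "b n" "\<not> b (Suc n)"
    obtain u where u: "u div 2 = j" "live_value b (Suc n) u 0"
      using live_value_child[OF ij(2)] b by auto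
    obtain v where v: "v div 2 = i" "live_value b (Suc n) v 2"
      using live_value_child[OF ij(1)] b by auto
    obtain v' where v': "v' div 2 = v" "live_value b (Suc (Suc n)) v' 1"
      using live_value_child[OF v(2)] b by auto
    have "live_value b (Suc (Suc n)) (2 * u) (- 1)"
      using live_value_0_children(1)[OF u(2)] b by simp
    then show ?thesis using v'(2)
      by (intro exI[of _ v'] exI[of _ "2 * u"]) (simp only: iterated_halves u(1) v(1) v'(1) insertI1 insertI2 singletonI simp_thms)
  next
    assume b: "\<not> b n" "b (Suc n)"
    obtain u where u: "u div 2 = i" "live_value b (Suc n) u 0"
      using live_value_child[OF ij(1)] b by auto
    obtain v where v: "v div 2 = j" "live_value b (Suc n) v (- 2)"
      using live_value_child[OF ij(2)] b by auto
    obtain v' where v': "v' div 2 = v" "live_value b (Suc (Suc n)) v' (- 1)"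
      using live_value_child[OF v(2)] b by auto
    have "live_value b (Suc (Suc n)) (2 * u) 1"
      using live_value_0_children(1)[OF u(2)] b by simp
    then show ?thesis using v'(2)
      by (intro exI[of _ "2 * u"] exI[of _ v']) (simp only: iterated_halves u(1) v(1) v'(1) insertI1 insertI2 singletonI simp_thms)
  next
    assume b: "\<not> b n" "\<not> b (Suc n)"
    obtain u v where uv: "u div 2 = i" "v div 2 = i" "live_value b (Suc n) u 0" "live_value b (Suc n) v 2"
      using live_value_split[of b n i] ij(1) b by auto
    obtain v' where v': "v' div 2 = v" "live_value b (Suc (Suc n)) v' 1"
      using live_value_child[OF uv(4)] b by auto
    have "live_value b (Suc (Suc n)) (2 * u) (- 1)"
      using live_value_0_children(1)[OF uv(3)] b by simp
    then show ?thesis using v'(2)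
      by (intro exI[of _ v'] exI[of _ "2 * u"]) (simp only: iterated_halves uv(1,2) v'(1) insertI1 insertI2 singletonI simp_thms)
  qed
  then obtain i' j' where "live_value b (Suc (Suc n)) i' 1" "live_value b (Suc (Suc n)) j' (- 1)"
     "i' div 4 \<in> {i, j}" "j' div 4 \<in> {i, j}" by blast
  then show ?thesis
    by (intro exI[of _ "(i', j')"]) (auto simp: opposite_pair_def members_def P)
qed

text \<open>
  The signs \<open>- + + -\<close>. During the first two signs the positive member passes through the value 0
  and is doubled, while the negative one makes an excursion to \<open>- 2\<close>; during the last two signs
  the roles are exchanged. In the end there are two members of either kind.
\<close>
definition splitting_block :: "(nat \<Rightarrow> bool) \<Rightarrow> nat \<Rightarrow> bool" where
  "splitting_block b n \<longleftrightarrow> \<not> b n \<and> b (n + 1) \<and> b (n + 2) \<and> \<not> b (n + 3)"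

lemma opposite_pair_split:
  assumes "opposite_pair b n P" "splitting_block b n"
  shows "\<exists>Q R. opposite_pair b (n + 4) Q \<and> (\<lambda>i. i div 16) ` members Q \<subseteq> members P
     \<and> opposite_pair b (n + 4) R \<and> (\<lambda>i. i div 16) ` members R \<subseteq> members P
     \<and> members Q \<inter> members R = {}"
proof -
  obtain i j where P: "P = (i, j)" by (cases P)
  have ij: "live_value b n i 1" "live_value b n j (- 1)"
    using assms(1) by (auto simp: opposite_pair_def P)
  have Suc3: "n + 3 = Suc (Suc (Suc n))" and Suc4: "n + 4 = Suc (Suc (Suc (Suc n)))" by simp_all
  have b: "\<not> b n" "b (Suc n)" "b (Suc (Suc n))" "\<not> b (Suc (Suc (Suc n)))"
    using assms(2) by (auto simp: splitting_block_def Suc3)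
  obtain u where u: "u div 2 = i" "live_value b (Suc n) u 0"
    using live_value_child[OF ij(1)] b by auto
  have u1: "live_value b (Suc (Suc n)) (2 * u) 1" "live_value b (Suc (Suc n)) (Suc (2 * u)) 1"
    using live_value_0_children[OF u(2)] b by simp_all
  obtain v where v: "v div 2 = j" "live_value b (Suc n) v (- 2)"
    using live_value_child[OF ij(2)] b by auto
  obtain v1 where v1: "v1 div 2 = v" "live_value b (Suc (Suc n)) v1 (- 1)"
    using live_value_child[OF v(2)] b by auto
  obtain v2 where v2: "v2 div 2 = v1" "live_value b (Suc (Suc (Suc n))) v2 0"
    using live_value_child[OF v1(2)] b by auto
  have neg: "live_value b (n + 4) (2 * v2) (- 1)" "live_value b (n + 4) (Suc (2 * v2)) (- 1)"
    using live_value_0_children[OF v2(2)] b unfolding Suc4 by simp_all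
  obtain w2 where w2: "w2 div 2 = 2 * u" "live_value b (Suc (Suc (Suc n))) w2 2"
    using live_value_child[OF u1(1)] b by auto
  obtain w3 where w3: "w3 div 2 = w2" "live_value b (n + 4) w3 1"
    using live_value_child[OF w2(2)] b unfolding Suc4 by auto
  obtain z2 where z2: "z2 div 2 = Suc (2 * u)" "live_value b (Suc (Suc (Suc n))) z2 2"
    using live_value_child[OF u1(2)] b by auto
  obtain z3 where z3: "z3 div 2 = z2" "live_value b (n + 4) z3 1"
    using live_value_child[OF z2(2)] b unfolding Suc4 by auto
  have "w3 div 16 = i" "z3 div 16 = i" "2 * v2 div 16 = j" "Suc (2 * v2) div 16 = j"
    by (simp_all only: iterated_halves w2(1) w3(1) z2(1) z3(1) u(1) v(1) v1(1) v2(1))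
  then have sub: "(\<lambda>i. i div 16) ` members (w3, 2 * v2) \<subseteq> members P"
    "(\<lambda>i. i div 16) ` members (z3, Suc (2 * v2)) \<subseteq> members P"
    by (auto simp only: members_def P fst_conv snd_conv)
  have "2 * u \<noteq> Suc (2 * u)" by simp
  then have "w3 \<noteq> z3" using w2(1) w3(1) z2(1) z3(1) by metis
  moreover have "x \<noteq> y" if "live_value b (n + 4) x 1" "live_value b (n + 4) y (- 1)" for x y
    using that by (auto simp: live_value_def)
  ultimately have "members (w3, 2 * v2) \<inter> members (z3, Suc (2 * v2)) = {}"
    using neg w3(2) z3(2) by (auto simp: members_def)
  then show ?thesis
    using neg w3(2) z3(2) sub
    by (intro exI[of _ "(w3, 2 * v2)"] exI[of _ "(z3, Suc (2 * v2))"])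
      (simp add: opposite_pair_def)
qed

text \<open>
  A child for either binary digit is provided in every case, so that trees of pairs can be defined
  uniformly; without a splitting block the two children may coincide.
\<close>
lemma opposite_pair_children:
  assumes "opposite_pair b n P"
  shows "\<exists>c. (\<forall>e. opposite_pair b (n + 4) (c e) \<and> (\<lambda>i. i div 16) ` members (c e) \<subseteq> members P)
     \<and> (splitting_block b n \<longrightarrow> members (c True) \<inter> members (c False) = {})"
proof (cases "splitting_block b n")
  case True
  obtain Q R where "opposite_pair b (n + 4) Q" "(\<lambda>i. i div 16) ` members Q \<subseteq> members P"
     "opposite_pair b (n + 4) R" "(\<lambda>i. i div 16) ` members R \<subseteq> members P"
     "members Q \<inter> members R = {}"
    using opposite_pair_split[OF assms True] by blast
  then show ?thesis by (intro exI[of _ "\<lambda>e. if e then Q else R"]) auto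
next
  case False
  obtain Q where Q: "opposite_pair b (Suc (Suc n)) Q" "(\<lambda>i. i div 4) ` members Q \<subseteq> members P"
    using opposite_pair_step2[OF assms] by blast
  obtain R where R: "opposite_pair b (Suc (Suc (Suc (Suc n)))) R" "(\<lambda>i. i div 4) ` members R \<subseteq> members Q"
    using opposite_pair_step2[OF Q(1)] by blast
  have "(\<lambda>i. i div 16) ` members R = (\<lambda>i. i div 4) ` (\<lambda>i. i div 4) ` members R"
    unfolding image_image by (simp flip: div_mult2_eq)
  then have "(\<lambda>i. i div 16) ` members R \<subseteq> members P"
    using Q(2) image_mono[OF R(2), of "\<lambda>i. i div 4"] by (simp only: subset_trans)
  moreover have "n + 4 = Suc (Suc (Suc (Suc n)))" by simp
  ultimately show ?thesis
    using False R(1) by (intro exI[of _ "\<lambda>e. R"]) (simp only: simp_thms)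
qed

lemma opposite_pair_Not: "opposite_pair (\<lambda>n. \<not> b n) n (i, j) \<longleftrightarrow> opposite_pair b n (j, i)"
  by (auto simp: opposite_pair_def live_value_def live_def outer_value_def node_Not)

text \<open>
  At the last visit of the walk to 1 before it becomes negative, the next two signs are negative.
  The leftmost segment of value 1 splits at the first of them; the half at 0 is carried to \<open>- 1\<close>
  and the half of value 2 to 1 by the second.
\<close>
lemma opposite_pair_if_walk_crosses_down:
  assumes "0 < walk b k" "walk b l < 0" "k < l"
  shows "\<exists>n P. opposite_pair b n P \<and> (\<forall>i\<in>members P. i < 2 ^ n)"
proof -
  define n where "n = Max {n \<in> {..l}. 0 < walk b n}"
  have "n \<in> {n \<in> {..l}. 0 < walk b n}"
    unfolding n_def using assms by (intro Max_in) (auto intro!: exI[of _ k])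
  then have n: "n \<le> l" "0 < walk b n" by auto
  have after: "walk b i \<le> 0" if "n < i" "i \<le> l" for i
  proof (rule ccontr)
    assume "\<not> walk b i \<le> 0"
    then have "i \<le> n" unfolding n_def using that by (intro Max_ge) auto
    then show False using that by simp
  qed
  have sg: "sg (b i) = 1 \<or> sg (b i) = - 1" for i by (simp add: sg_def)
  have "n \<noteq> l" using n assms by auto
  then have 1: "walk b n = 1" "sg (b n) = - 1" using n after[of "Suc n"] sg[of n] by auto
  then have "Suc n \<noteq> l" using assms(2) by auto
  then have 2: "sg (b (Suc n)) = - 1"
    using n after[of "Suc (Suc n)"] \<open>n \<noteq> l\<close> sg[of "Suc n"] 1 by auto
  have "live_value b n 0 1" by (simp add: live_value_def live_def outer_value_def node_at_1 1)
  have a: "node b (Suc n) (Suc 0) = 0" "node b (Suc n) (Suc (Suc 0)) = 2"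
    using node_odd[of b n 0] node_even_Suc[of b n 0] 1 by (simp_all add: node_at_1)
  have c: "node b (Suc (Suc n)) (Suc 0) = - 1" "node b (Suc (Suc n)) (Suc (Suc 0)) = 0"
    using node_odd[of b "Suc n" 0] node_even_Suc[of b "Suc n" 0] 2 by (simp_all add: a)
  have "2 * Suc 0 = Suc (Suc 0)" by simp
  then have "node b (Suc (Suc n)) (Suc (Suc (Suc 0))) = 1"
    using node_odd[of b "Suc n" "Suc 0"] 2 by (simp only: a)
  then have "opposite_pair b (Suc (Suc n)) (Suc (Suc 0), 0)"
    by (simp add: opposite_pair_def live_value_def live_def outer_value_def c)
  moreover have "Suc (Suc 0) < 2 ^ Suc (Suc n)" 
    unfolding power_Suc using zero_less_power[of "2::nat" n] by linarith
  ultimately show ?thesis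
    by (intro exI[of _ "Suc (Suc n)"] exI[of _ "(Suc (Suc 0), 0)"]) (auto simp: members_def)
qed

lemma opposite_pair_if_walk_changes_sign:
  assumes "0 < walk b k" "walk b l < 0"
  shows "\<exists>n P. opposite_pair b n P \<and> (\<forall>i\<in>members P. i < 2 ^ n)"
proof (cases "k < l")
  case True
  then show ?thesis using opposite_pair_if_walk_crosses_down assms by blast
next
  case False
  moreover have "k \<noteq> l" using assms by auto
  ultimately obtain n P where P: "opposite_pair (\<lambda>n. \<not> b n) n P" "\<forall>i\<in>members P. i < 2 ^ n"
    using opposite_pair_if_walk_crosses_down[of "\<lambda>n. \<not> b n" l k] assms by (auto simp: walk_Not)
  have "opposite_pair b n (snd P, fst P)"
    using P(1) opposite_pair_Not[of b n "fst P" "snd P"] by (simp only: prod.collapse)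
  moreover have "members (snd P, fst P) = members P" by (auto simp: members_def)
  ultimately show ?thesis using P(2) by (intro exI[of _ n] exI[of _ "(snd P, fst P)"]) (simp only: simp_thms)
qed

section \<open>Hausdorff measure of sets described by dyadic segments\<close>

lemma diameter_seg: "diameter (seg n m) = (1/2) ^ n"
proof -
  have "real m / 2 ^ n \<le> real (Suc m) / 2 ^ n" by (intro divide_right_mono) auto
  then have "diameter (seg n m) = real (Suc m) / 2 ^ n - real m / 2 ^ n"
    unfolding seg_def diameter_closed_interval by (simp only: not_less[symmetric] if_False)
  also have "\<dots> = (1/2) ^ n" by (simp add: power_one_over flip: diff_divide_distrib)
  finally show ?thesis .
qed

text \<open>
  Covers with two indices are admissible too, which suits covers by families sorted by level.
\<close>
lemma hausdorff_premeasure_le_suminf: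
  fixes U :: "nat \<Rightarrow> nat \<Rightarrow> 'a::metric_space set"
  assumes cover: "A \<subseteq> (\<Union>i. \<Union>j. U i j)"
    and U: "\<And>i j. bounded (U i j)" "\<And>i j. diameter (U i j) \<le> \<delta>"
  shows "hausdorff_premeasure s \<delta> A \<le> (\<Sum>i. \<Sum>j. diam_pow s (U i j))"
proof -
  define V where "V k = (case prod_decode k of (i, j) \<Rightarrow> U i j)" for k
  have V: "V (prod_encode (i, j)) = U i j" for i j by (simp add: V_def)
  have "hausdorff_premeasure s \<delta> A \<le> (\<Sum>k. diam_pow s (V k))"
    unfolding hausdorff_premeasure_def
  proof (rule INF_lower, intro CollectI conjI allI)
    show "A \<subseteq> (\<Union>k. V k)"
    proof
      fix x assume "x \<in> A"
      then obtain i j where "x \<in> U i j" using cover by blast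
      then have "x \<in> V (prod_encode (i, j))" by (simp only: V)
      then show "x \<in> (\<Union>k. V k)" by blast
    qed
    show "bounded (V k)" "diameter (V k) \<le> \<delta>" for k using U by (auto simp: V_def split: prod.split)
  qed
  also have "\<dots> = (\<Sum>k. (\<lambda>(i, j). diam_pow s (U i j)) (prod_decode k))"
    unfolding V_def by (intro suminf_cong) (simp split: prod.split)
  also have "\<dots> = (\<Sum>i. \<Sum>j. diam_pow s (U i j))"
    by (rule suminf_ennreal_2dimen) simp
  finally show ?thesis .
qed

lemma hausdorff_dim_le: "0 \<le> s \<Longrightarrow> hausdorff_measure s A = 0 \<Longrightarrow> hausdorff_dim A \<le> ennreal s"
  unfolding hausdorff_dim_def by (rule INF_lower) simp

lemma hausdorff_dim_ge:
  assumes "\<And>r. 0 \<le> r \<Longrightarrow> r \<le> s \<Longrightarrow> hausdorff_measure r A \<noteq> 0"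
  shows "ennreal s \<le> hausdorff_dim A"
  unfolding hausdorff_dim_def
proof (rule INF_greatest)
  fix r assume "r \<in> {s. 0 \<le> s \<and> hausdorff_measure s A = 0}"
  then have "s \<le> r" using assms[of r] by (cases "r \<le> s") auto
  then show "ennreal s \<le> ennreal r" by (rule ennreal_leI)
qed

lemma half_power_powr: "((1/2) ^ n) powr s = (1 / 2 powr s) ^ n" for s :: real
proof (induction n)
  case (Suc n)
  have "((1/2) ^ Suc n) powr s = (1/2) powr s * ((1/2) ^ n) powr s"
    unfolding power_Suc by (subst powr_mult) simp_all
  also have "(1/2) powr s = 1 / 2 powr s" by (simp add: powr_divide)
  finally show ?case using Suc by simp
qed simp

lemma suminf_head_ennreal:
  fixes f :: "nat \<Rightarrow> ennreal" shows "suminf f = f 0 + (\<Sum>i. f (Suc i))"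
proof -
  have "f sums ((\<Sum>i. f (Suc i)) + f 0)" by (intro sums_Suc summable_sums summableI)
  then show ?thesis using sums_unique by (metis add.commute)
qed

text \<open>
  The first Borel-Cantelli lemma for Hausdorff measure: the tail of the families \<open>K n\<close> covers
  everything except \<open>D\<close>, and its total cost is the tail of a geometric series. The countable set
  \<open>D\<close> is covered by its points, at cost 0 since the exponent is positive.
\<close>
lemma hausdorff_measure_limsup_eq_0:
  fixes K :: "nat \<Rightarrow> nat set"
  assumes D: "countable D" and s: "0 < s"
    and fin: "\<And>n. finite (K n)" and \<kappa>: "0 < \<kappa>" "\<kappa> < 2 powr s"
    and card: "\<And>n. n0 \<le> n \<Longrightarrow> real (card (K n)) \<le> c * \<kappa> ^ n"
    and cover: "\<And>x N. x \<in> X \<Longrightarrow> x \<notin> D \<Longrightarrow> \<exists>n\<ge>N. \<exists>m\<in>K n. x \<in> seg n m"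
  shows "hausdorff_measure s X = 0"
proof -
  define r where "r = \<kappa> / 2 powr s"
  have r: "0 < r" "r < 1" using \<kappa> by (auto simp: r_def)
  have "0 \<le> c"
  proof -
    have "0 \<le> c * \<kappa> ^ n0" using card[of n0] by (rule order_trans[OF of_nat_0_le_iff]) simp
    then show ?thesis
      using mult_neg_pos[OF _ zero_less_power[OF \<kappa>(1)], of c n0] by (meson not_le)
  qed
  have diam: "diam_pow s (seg n m) = ennreal ((1 / 2 powr s) ^ n)" for n m
  proof -
    have "m / 2 ^ n \<in> seg n m"
      unfolding seg_def atLeastAtMost_iff by (intro conjI divide_right_mono) simp_all
    then have "seg n m \<noteq> {}" by blast
    then show ?thesis using s by (simp add: diam_pow_def diameter_seg half_power_powr)
  qed
  have bound: "hausdorff_premeasure s \<delta> X \<le> ennreal (c * r ^ N / (1 - r))"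
    if N: "n0 \<le> N" "(1/2) ^ N \<le> \<delta>" for \<delta> N
  proof -
    \<comment> \<open>The row with index 0 takes care of \<open>D\<close>, the others of the levels from \<open>N\<close> on.\<close>
    define U where "U i j = (case i of
        0 \<Rightarrow> (if D = {} then {} else {from_nat_into D j})
      | Suc i \<Rightarrow> (if j \<in> K (N + i) then seg (N + i) j else {}))" for i j
    have "0 \<le> \<delta>" using N(2) by (rule order_trans[rotated]) simp
    have dle: "(1/2) ^ (N + i) \<le> \<delta>" for i
      using N(2) by (rule order_trans[rotated]) (intro power_decreasing; simp)
    have "hausdorff_premeasure s \<delta> X \<le> (\<Sum>i. \<Sum>j. diam_pow s (U i j))"
    proof (rule hausdorff_premeasure_le_suminf)
      show "X \<subseteq> (\<Union>i. \<Union>j. U i j)"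
      proof
        fix x assume "x \<in> X"
        show "x \<in> (\<Union>i. \<Union>j. U i j)"
        proof (cases "x \<in> D")
          case True
          then obtain j where "from_nat_into D j = x" using from_nat_into_surj[OF D] by blast
          then have "x \<in> U 0 j" using True by (auto simp: U_def)
          then show ?thesis by blast
        next
          case False
          then obtain n m where nm: "N \<le> n" "m \<in> K n" "x \<in> seg n m" using cover \<open>x \<in> X\<close> by blast
          then have "x \<in> U (Suc (n - N)) m" by (simp add: U_def)
          then show ?thesis by blast
        qed
      qed
      show "bounded (U i j)" for i j by (auto simp: U_def seg_def split: nat.split)
      show "diameter (U i j) \<le> \<delta>" for i j
        using \<open>0 \<le> \<delta>\<close> dle by (auto simp: U_def diameter_seg split: nat.split)
    qed
    also have "\<dots> = (\<Sum>j. diam_pow s (U 0 j)) + (\<Sum>i. \<Sum>j. diam_pow s (U (Suc i) j))"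
      by (rule suminf_head_ennreal)
    also have "(\<Sum>j. diam_pow s (U 0 j)) = 0"
    proof -
      have "diam_pow s (U 0 j) = 0" for j using s by (simp add: U_def diam_pow_def)
      then show ?thesis by simp
    qed
    also have "(\<Sum>i. \<Sum>j. diam_pow s (U (Suc i) j)) \<le> (\<Sum>i. ennreal (c * r ^ N * r ^ i))"
    proof (rule suminf_le)
      fix i
      have "(\<Sum>j. diam_pow s (U (Suc i) j)) = (\<Sum>j\<in>K (N + i). diam_pow s (U (Suc i) j))"
        by (rule suminf_finite[OF fin]) (simp add: U_def diam_pow_def)
      also have "\<dots> = (\<Sum>j\<in>K (N + i). ennreal ((1 / 2 powr s) ^ (N + i)))"
        by (intro sum.cong refl) (simp add: U_def diam)
      also have "\<dots> = ennreal (real (card (K (N + i))) * (1 / 2 powr s) ^ (N + i))"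
        by (simp add: ennreal_of_nat_eq_real_of_nat ennreal_mult)
      also have "\<dots> \<le> ennreal (c * \<kappa> ^ (N + i) * (1 / 2 powr s) ^ (N + i))"
        using card[of "N + i"] N(1) by (intro ennreal_leI mult_right_mono) auto
      also have "c * \<kappa> ^ (N + i) * (1 / 2 powr s) ^ (N + i) = c * r ^ N * r ^ i"
        by (simp add: r_def power_divide power_add)
      finally show "(\<Sum>j. diam_pow s (U (Suc i) j)) \<le> ennreal (c * r ^ N * r ^ i)" .
    qed simp_all
    also have "(\<Sum>i. ennreal (c * r ^ N * r ^ i)) = ennreal (c * r ^ N * (1 / (1 - r)))"
      using r \<open>0 \<le> c\<close>
      by (intro suminf_ennreal_eq sums_mult geometric_sums mult_nonneg_nonneg) auto
    finally show ?thesis by simp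
  qed
  have "hausdorff_premeasure s \<delta> X \<le> 0" if "0 < \<delta>" for \<delta>
  proof -
    have "\<exists>M. (1/2) ^ M < \<delta>" by (rule real_arch_pow_inv[OF that]) simp
    then obtain M where M: "(1/2) ^ M < \<delta>" by blast
    have "(\<lambda>N. c * r ^ N / (1 - r)) \<longlonglongrightarrow> c * 0 / (1 - r)"
      using r by (intro tendsto_intros LIMSEQ_realpow_zero) auto
    then have "(\<lambda>N. ennreal (c * r ^ N / (1 - r))) \<longlonglongrightarrow> ennreal 0"
      by (intro tendsto_ennrealI) simp
    moreover have "hausdorff_premeasure s \<delta> X \<le> ennreal (c * r ^ N / (1 - r))"
      if "max n0 M \<le> N" for N
    proof (rule bound)
      show "n0 \<le> N" using that by simp
      have "(1/2::real) ^ N \<le> (1/2) ^ M" using that by (intro power_decreasing) auto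
      then show "(1/2) ^ N \<le> \<delta>" using M by linarith
    qed
    ultimately show ?thesis using LIMSEQ_le_const[of _ "ennreal 0"] unfolding ennreal_0 by blast
  qed
  then have "hausdorff_measure s X \<le> 0"
    unfolding hausdorff_measure_def by (intro SUP_least) simp
  then show ?thesis by simp 
qed

lemma hausdorff_dim_countable:
  fixes A :: "real set"
  assumes "countable A" shows "hausdorff_dim A = 0"
proof -
  have "hausdorff_dim A \<le> ennreal s" if "0 < s" for s
    using that hausdorff_measure_limsup_eq_0[OF assms that, of "\<lambda>_. {}" 1 0 0 A]
      gr_one_powr[of 2 s] by (intro hausdorff_dim_le) auto
  then have "hausdorff_dim A \<le> 0 + ennreal s" if "0 < s" for s using that by simp
  then show ?thesis using ennreal_le_epsilon[of 0 "hausdorff_dim A"] by simp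
qed

lemma seg_coarser: "seg (n + k) i \<subseteq> seg n (i div 2 ^ k)"
proof (induction k arbitrary: i)
  case (Suc k)
  have "seg (n + Suc k) i \<subseteq> seg (n + k) (i div 2)" using seg_parent[of "n + k" i] by simp
  also have "\<dots> \<subseteq> seg n (i div 2 div 2 ^ k)" by (rule Suc)
  finally show ?case by (simp add: div_mult2_eq)
qed simp

text \<open>
  If \<open>u\<close> is a point of \<open>U\<close>, the indices of the segments in question are integers in the closed
  interval of length 3 from \<open>2 ^ n * u - 2\<close> to \<open>2 ^ n * u + 1\<close>.
\<close>
lemma card_segs_meeting_small_set:
  assumes "bounded U" "diameter U \<le> (1/2) ^ n"
  shows "finite {i. seg n i \<inter> U \<noteq> {}} \<and> card {i. seg n i \<inter> U \<noteq> {}} \<le> 4"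
proof (cases "U = {}")
  case False
  then obtain u where u: "u \<in> U" by blast
  let ?J = "{i. seg n i \<inter> U \<noteq> {}}" and ?I = "{\<lceil>2 ^ n * u - 2\<rceil>..\<lfloor>2 ^ n * u + 1\<rfloor>}"
  have "int ` ?J \<subseteq> ?I"
  proof
    fix z assume "z \<in> int ` ?J"
    then obtain i y where i: "z = int i" "y \<in> seg n i" "y \<in> U" by blast
    have "\<bar>y - u\<bar> \<le> (1/2) ^ n"
      using diameter_bounded_bound[OF assms(1) i(3) u] assms(2) by (simp add: dist_real_def)
    then have "2 ^ n * \<bar>y - u\<bar> \<le> 2 ^ n * (1/2) ^ n" by (intro mult_left_mono) auto
    then have "\<bar>2 ^ n * y - 2 ^ n * u\<bar> \<le> 1"
      by (simp add: power_one_over abs_mult flip: right_diff_distrib)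
    moreover have "real i \<le> 2 ^ n * y" "2 ^ n * y \<le> real i + 1"
      using i(2) by (auto simp: seg_def field_simps)
    ultimately have "2 ^ n * u - 2 \<le> of_int (int i)" "of_int (int i) \<le> 2 ^ n * u + 1" by auto
    then show "z \<in> ?I" unfolding i(1) by (simp only: ceiling_le_iff le_floor_iff atLeastAtMost_iff)
  qed
  moreover have "card ?I \<le> 4" by (simp, linarith)
  ultimately have "finite (int ` ?J)" "card (int ` ?J) \<le> 4"
    using finite_subset[of "int ` ?J" ?I] order_trans[OF card_mono[of ?I "int ` ?J"]]
    by (metis finite_atLeastAtMost_int)+
  then show ?thesis by (simp add: finite_image_iff card_image)
qed simp

text \<open>
  A mass distribution argument. \<open>Q k c\<close> is a finite family of segments of level \<open>a + 4 * k\<close>,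
  thought of as a node of a tree; the nodes of depth \<open>k\<close> are numbered by \<open>D k\<close> binary digits and
  the parent of a node is obtained by dropping the last digits. Every \<open>t \<in> [0, 1)\<close>, through the
  binary digits of \<open>t\<close>, determines a branch of the tree and a point \<open>pt t\<close> on it. The mass is the
  image of Lebesgue measure under \<open>pt\<close>. A set of diameter at most \<open>(1/2) ^ (a + 4 * k)\<close> meets at
  most four segments of that level, hence at most four nodes of depth \<open>k\<close>, and so has mass at most
  \<open>4 * (1/2) ^ D k\<close>. As \<open>pt\<close> need not be measurable, this is phrased with measurable
  sets that contain the preimages.
\<close>
lemma hausdorff_measure_nonzero_of_branching:
  fixes Q :: "nat \<Rightarrow> nat \<Rightarrow> nat set" and D :: "nat \<Rightarrow> nat"
  assumes fin: "\<And>k c. finite (Q k c)" and ne: "\<And>k c. Q k c \<noteq> {}"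
    and D0: "D 0 = 0" and mono: "\<And>k. D k \<le> D (Suc k)"
    and nested: "\<And>k c. (\<lambda>i. i div 16) ` Q (Suc k) c \<subseteq> Q k (c div 2 ^ (D (Suc k) - D k))"
    and disj: "\<And>k c c'. c < 2 ^ D k \<Longrightarrow> c' < 2 ^ D k \<Longrightarrow> c \<noteq> c' \<Longrightarrow> Q k c \<inter> Q k c' = {}"
    and unbdd: "filterlim D at_top sequentially"
    and s: "0 \<le> s" and growth: "\<And>k. k0 \<le> k \<Longrightarrow> 4 * s * real k \<le> real (D k)"
    and limit: "\<And>x c. (\<And>k. \<exists>i\<in>Q k (c k). x \<in> seg (a + 4 * k) i) \<Longrightarrow> x \<in> X"
  shows "hausdorff_measure s X \<noteq> 0"
proof -
  define addr where "addr t k = nat \<lfloor>2 ^ D k * t\<rfloor>" for t :: real and k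
  have addr_div: "addr t (Suc k) div 2 ^ (D (Suc k) - D k) = addr t k" if "0 \<le> t" for t k
  proof -
    define e where "e = D (Suc k) - D k"
    have e: "D (Suc k) = D k + e" using mono[of k] by (simp add: e_def)
    have "\<lfloor>2 ^ D k * t\<rfloor> = \<lfloor>2 ^ D (Suc k) * t / of_int (2 ^ e)\<rfloor>"
      by (simp add: e power_add)
    also have "\<dots> = \<lfloor>2 ^ D (Suc k) * t\<rfloor> div 2 ^ e"
      using floor_divide_real_eq_div[of "2 ^ e" "2 ^ D (Suc k) * t"] by simp
    finally have "addr t k = nat (\<lfloor>2 ^ D (Suc k) * t\<rfloor> div 2 ^ e)" by (simp only: addr_def)
    also have "\<dots> = addr t (Suc k) div 2 ^ e"
      using that by (simp add: addr_def nat_div_distrib nat_power_eq)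
    finally show ?thesis by (simp only: e_def)
  qed
  have addr_less: "addr t k < 2 ^ D k" if "0 \<le> t" "t < 1" for t k
  proof -
    have "2 ^ D k * t < 2 ^ D k" using that by simp
    then have "\<lfloor>2 ^ D k * t\<rfloor> < 2 ^ D k" by (simp add: floor_less_iff)
    then show ?thesis using that by (simp add: addr_def nat_less_iff)
  qed
  have addr_mem: "t \<in> {real (addr t k) / 2 ^ D k .. real (Suc (addr t k)) / 2 ^ D k}" if "0 \<le> t" for t k
  proof -
    have "real (addr t k) = of_int \<lfloor>2 ^ D k * t\<rfloor>" using that by (simp add: addr_def)
    then have "real (addr t k) \<le> 2 ^ D k * t" "2 ^ D k * t \<le> real (Suc (addr t k))" by linarith+
    then show ?thesis by (simp add: field_simps)
  qed
  have "\<exists>x. \<forall>k. \<exists>i\<in>Q k (addr t k). x \<in> seg (a + 4 * k) i" if "0 \<le> t" for t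
  proof -
    define F where "F k = (\<Union>i\<in>Q k (addr t k). seg (a + 4 * k) i)" for k
    have "\<Inter>(range F) \<noteq> {}"
    proof (rule compact_nest)
      show "compact (F k)" for k unfolding F_def seg_def by (intro compact_UN fin) simp
      show "F k \<noteq> {}" for k
      proof -
        obtain i where "i \<in> Q k (addr t k)" using ne by blast
        moreover have "real i / 2 ^ (a + 4 * k) \<in> seg (a + 4 * k) i"
          unfolding seg_def atLeastAtMost_iff by (intro conjI divide_right_mono) simp_all
        ultimately show ?thesis unfolding F_def by blast
      qed
      have step: "F (Suc k) \<subseteq> F k" for k
      proof
        fix x assume "x \<in> F (Suc k)"
        then obtain i where i: "i \<in> Q (Suc k) (addr t (Suc k))" "x \<in> seg (a + 4 * Suc k) i"
          by (auto simp: F_def)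
        have "i div 16 \<in> Q k (addr t k)"
          using nested[of k "addr t (Suc k)"] i(1) unfolding addr_div[OF that] by blast
        moreover have "x \<in> seg (a + 4 * k) (i div 16)"
          using seg_coarser[of "a + 4 * k" 4 i] i(2) by (auto simp: ac_simps)
        ultimately show "x \<in> F k" unfolding F_def by blast
      qed
      show "F n \<subseteq> F m" if "m \<le> n" for m n
        using that step by (rule lift_Suc_antimono_le[rotated])
    qed
    then obtain x where "\<And>k. x \<in> F k" by blast
    then have "\<forall>k. \<exists>i\<in>Q k (addr t k). x \<in> seg (a + 4 * k) i" by (simp add: F_def)
    then show ?thesis ..
  qed
  then have "\<forall>t. \<exists>x. 0 \<le> t \<longrightarrow> (\<forall>k. \<exists>i\<in>Q k (addr t k). x \<in> seg (a + 4 * k) i)"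
    by blast
  then obtain pt where pt: "\<And>t k. 0 \<le> t \<Longrightarrow> \<exists>i\<in>Q k (addr t k). pt t \<in> seg (a + 4 * k) i"
    by metis
  have pt_X: "pt t \<in> X" if "0 \<le> t" for t using limit pt[OF that] by blast
  define T where "T U = {t. 0 \<le> t \<and> t < 1 \<and> pt t \<in> U}" for U
  have level: "\<exists>B\<in>sets lborel. T U \<subseteq> B \<and> emeasure lborel B \<le> ennreal (4 * (1/2) ^ D k)"
    if U: "bounded U" "diameter U \<le> (1/2) ^ (a + 4 * k)" for U k
  proof -
    define J where "J = {i. seg (a + 4 * k) i \<inter> U \<noteq> {}}"
    have J: "finite J" "card J \<le> 4" unfolding J_def using card_segs_meeting_small_set[OF U] by auto
    define C where "C = {c. c < 2 ^ D k \<and> Q k c \<inter> J \<noteq> {}}"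
    have "finite C" unfolding C_def by (rule finite_subset[of _ "{..<2 ^ D k}"]) auto
    define g where "g c = (SOME i. i \<in> Q k c \<inter> J)" for c
    have g: "g c \<in> Q k c \<inter> J" if "c \<in> C" for c
      using that some_in_eq[of "Q k c \<inter> J"] unfolding C_def g_def by blast
    have "inj_on g C"
    proof (rule inj_onI, rule ccontr)
      fix c c' assume cc: "c \<in> C" "c' \<in> C" "g c = g c'" "c \<noteq> c'"
      then have "Q k c \<inter> Q k c' = {}" using disj[of c k c'] by (simp add: C_def)
      then show False using g[OF cc(1)] g[OF cc(2)] cc(3) by auto
    qed
    then have "card C \<le> card J" using g J(1) by (intro card_inj_on_le[of g]) auto
    then have C4: "card C \<le> 4" using J by simp
    define I where "I c = {real c / 2 ^ D k .. real (Suc c) / 2 ^ D k}" for c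
    have I: "emeasure lborel (I c) = ennreal ((1/2) ^ D k)" for c
    proof -
      have le: "real c / 2 ^ D k \<le> real (Suc c) / 2 ^ D k" by (intro divide_right_mono) auto
      have "real (Suc c) / 2 ^ D k - real c / 2 ^ D k = (1/2) ^ D k"
        by (simp add: power_one_over flip: diff_divide_distrib)
      then show ?thesis unfolding I_def using emeasure_lborel_Icc[OF le] by (simp only:)
    qed
    have TU: "T U \<subseteq> (\<Union>c\<in>C. I c)"
    proof
      fix t assume "t \<in> T U"
      then have t: "0 \<le> t" "t < 1" "pt t \<in> U" by (auto simp: T_def)
      obtain i where i: "i \<in> Q k (addr t k)" "pt t \<in> seg (a + 4 * k) i" using pt[OF t(1)] by blast
      have "i \<in> J" using i(2) t(3) by (auto simp: J_def)
      then have "addr t k \<in> C" using i(1) addr_less[OF t(1,2)] by (auto simp: C_def)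
      moreover have "t \<in> I (addr t k)" unfolding I_def by (rule addr_mem[OF t(1)])
      ultimately show "t \<in> (\<Union>c\<in>C. I c)" by blast
    qed
    have "emeasure lborel (\<Union>c\<in>C. I c) \<le> (\<Sum>c\<in>C. emeasure lborel (I c))"
      by (rule emeasure_subadditive_finite[OF \<open>finite C\<close>]) (auto simp: I_def)
    also have "\<dots> = ennreal (real (card C) * (1/2) ^ D k)"
      unfolding I by (simp add: ennreal_of_nat_eq_real_of_nat ennreal_mult)
    also have "\<dots> \<le> ennreal (4 * (1/2) ^ D k)"
      using C4 by (intro ennreal_leI mult_right_mono) auto
    finally have "emeasure lborel (\<Union>c\<in>C. I c) \<le> ennreal (4 * (1/2) ^ D k)" .
    moreover have "(\<Union>c\<in>C. I c) \<in> sets lborel"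
      using \<open>finite C\<close> by (intro sets.finite_UN) (auto simp: I_def)
    ultimately show ?thesis using TU by (intro bexI[of _ "\<Union>c\<in>C. I c"] conjI)
  qed
  \<comment> \<open>The four segments account for the factor 4; passing from level \<open>a + 4 * Suc k\<close> to \<open>4 * k\<close> costs the exponent \<open>a + 4\<close>.\<close>
  define E where "E = 4 * 2 powr (s * (real a + 4))"
  define \<delta> :: real where "\<delta> = (1/2) ^ (a + 4 * k0)"
  have piece: "\<exists>B\<in>sets lborel. T U \<subseteq> B \<and> emeasure lborel B \<le> ennreal E * diam_pow s U"
    if U: "bounded U" "diameter U \<le> \<delta>" for U
  proof -
    have "0 \<le> diameter U" by (rule diameter_ge_0[OF U(1)])
    then consider "diameter U = 0" | "0 < diameter U" by linarith
    then show ?thesis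
    proof cases
      case 1
      have "\<forall>k. \<exists>B. B \<in> sets lborel \<and> T U \<subseteq> B \<and> emeasure lborel B \<le> ennreal (4 * (1/2) ^ D k)"
        using level[OF U(1)] 1 by (auto simp: Bex_def)
      then obtain B where B: "\<And>k. B k \<in> sets lborel" "\<And>k. T U \<subseteq> B k"
          "\<And>k. emeasure lborel (B k) \<le> ennreal (4 * (1/2) ^ D k)" by metis
      \<comment> \<open>A set of diameter 0 may have cost 0, so the bounds of all levels have to be used at once.\<close>
      have meas: "(\<Inter>k. B k) \<in> sets lborel" by (intro sets.countable_INT) (use B(1) in auto)
      have "((\<lambda>k. (1/2::real) ^ D k) \<longlongrightarrow> 0) sequentially"
        by (rule filterlim_compose[OF LIMSEQ_realpow_zero unbdd]) simp_all
      then have "(\<lambda>k. ennreal (4 * (1/2) ^ D k)) \<longlonglongrightarrow> ennreal (4 * 0)"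
        by (intro tendsto_ennrealI tendsto_intros)
      moreover have "emeasure lborel (\<Inter>k. B k) \<le> ennreal (4 * (1/2) ^ D k)" for k
        using emeasure_mono[of "\<Inter>k. B k" "B k" lborel] B(1) order_trans[OF _ B(3)[of k]] by blast
      ultimately have "emeasure lborel (\<Inter>k. B k) \<le> ennreal (4 * 0)"
        using LIMSEQ_le_const by blast
      then have "emeasure lborel (\<Inter>k. B k) \<le> ennreal E * diam_pow s U" by simp
      moreover have "T U \<subseteq> (\<Inter>k. B k)" using B(2) by (intro INT_greatest)
      ultimately show ?thesis using meas by blast
    next
      case 2
      define d where "d = diameter U"
      let ?P = "\<lambda>k. d \<le> (1/2) ^ (a + 4 * k)"
      obtain M where M: "(1/2) ^ M < d" using real_arch_pow_inv[of d "1/2"] 2 unfolding d_def by fastforce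
      have bdd: "k \<le> M" if "?P k" for k
      proof (rule ccontr)
        assume "\<not> k \<le> M"
        then have "(1/2::real) ^ (a + 4 * k) \<le> (1/2) ^ M" by (intro power_decreasing) auto
        then show False using M that by linarith
      qed
      \<comment> \<open>The finest admissible level, so that the diameter is comparable with the length of its segments.\<close>
      define k where "k = (GREATEST k. ?P k)"
      have Pk0: "?P k0" using U(2) by (simp add: d_def \<delta>_def)
      have k: "?P k" "k0 \<le> k" "\<not> ?P (Suc k)"
      proof -
        show "?P k" unfolding k_def by (rule GreatestI_nat[of ?P, OF Pk0 bdd])
        show "k0 \<le> k" unfolding k_def by (rule Greatest_le_nat[of ?P, OF Pk0 bdd])
        show "\<not> ?P (Suc k)" using Greatest_le_nat[of ?P "Suc k", OF _ bdd] unfolding k_def[symmetric] by force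
      qed
      obtain B where B: "B \<in> sets lborel" "T U \<subseteq> B" "emeasure lborel B \<le> ennreal (4 * (1/2) ^ D k)"
        using level[OF U(1)] k(1) unfolding d_def by blast
      have "4 * (1/2) ^ D k \<le> E * d powr s"
      proof -
        have "(1/2) ^ D k = (1/2) powr real (D k)" by (simp add: powr_realpow)
        also have "\<dots> \<le> (1/2) powr (4 * s * real k)"
          using growth[OF k(2)] by (intro powr_mono') auto
        also have "\<dots> = 2 powr (s * (real a + 4)) * (1/2) powr (s * real (a + 4 * Suc k))"
        proof -
          have half: "(1/2) powr y = 2 powr (- y)" for y :: real
            by (simp add: powr_divide powr_minus_divide)
          have "- (4 * s * real k) = s * (real a + 4) + - (s * real (a + 4 * Suc k))"
            by (simp add: algebra_simps)
          then show ?thesis unfolding half by (simp only: powr_add)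
        qed
        also have "(1/2) powr (s * real (a + 4 * Suc k)) = ((1/2) ^ (a + 4 * Suc k)) powr s"
          by (subst powr_realpow[symmetric], simp) (simp only: powr_powr mult.commute)
        also have "\<dots> \<le> d powr s"
          using k(3) s by (intro powr_mono2) auto
        finally have "(1/2) ^ D k \<le> 2 powr (s * (real a + 4)) * d powr s"
          by (simp add: mult_left_mono)
        then show ?thesis by (simp add: E_def)
      qed
      then have "ennreal (4 * (1/2) ^ D k) \<le> ennreal (E * d powr s)" by (rule ennreal_leI)
      also have "\<dots> = ennreal E * ennreal (d powr s)" by (simp add: E_def ennreal_mult)
      also have "ennreal (d powr s) = diam_pow s U"
        using 2 by (auto simp: diam_pow_def d_def)
      finally have "emeasure lborel B \<le> ennreal E * diam_pow s U" by (rule order_trans[OF B(3)])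
      then show ?thesis using B(1,2) by (intro bexI[of _ B] conjI)
    qed
  qed
  have E: "0 < E" by (simp add: E_def)
  have "ennreal (1 / E) \<le> hausdorff_premeasure s \<delta> X"
    unfolding hausdorff_premeasure_def
  proof (rule INF_greatest)
    fix U assume "U \<in> {U. X \<subseteq> (\<Union>i::nat. U i) \<and> (\<forall>i. bounded (U i) \<and> diameter (U i) \<le> \<delta>)}"
    then have U: "X \<subseteq> (\<Union>i. U i)" "\<And>i. bounded (U i)" "\<And>i. diameter (U i) \<le> \<delta>" by auto
    have "\<forall>i. \<exists>B. B \<in> sets lborel \<and> T (U i) \<subseteq> B \<and> emeasure lborel B \<le> ennreal E * diam_pow s (U i)"
      using piece[OF U(2,3)] by (auto simp: Bex_def)
    then obtain B where B: "\<And>i. B i \<in> sets lborel" "\<And>i. T (U i) \<subseteq> B i"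
        "\<And>i. emeasure lborel (B i) \<le> ennreal E * diam_pow s (U i)" by metis
    have "{0..<1} \<subseteq> (\<Union>i. B i)"
    proof
      fix t :: real assume t: "t \<in> {0..<1}"
      then obtain i where "pt t \<in> U i" using pt_X[of t] U(1) by auto
      then have "t \<in> T (U i)" using t by (simp add: T_def)
      then show "t \<in> (\<Union>i. B i)" using B(2) by blast
    qed
    then have "emeasure lborel {0..<1::real} \<le> emeasure lborel (\<Union>i. B i)"
      using B(1) by (intro emeasure_mono) auto
    also have "\<dots> \<le> (\<Sum>i. emeasure lborel (B i))"
      using B(1) by (intro emeasure_subadditive_countably) auto
    also have "\<dots> \<le> (\<Sum>i. ennreal E * diam_pow s (U i))"
      by (intro suminf_le B(3) summableI)
    also have "\<dots> = ennreal E * (\<Sum>i. diam_pow s (U i))" by simp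
    finally have "1 \<le> ennreal E * (\<Sum>i. diam_pow s (U i))" by simp
    then have "ennreal (1 / E) * 1 \<le> ennreal (1 / E) * (ennreal E * (\<Sum>i. diam_pow s (U i)))"
      by (rule mult_left_mono) simp
    also have "\<dots> = (\<Sum>i. diam_pow s (U i))"
      using E by (simp add: mult.assoc[symmetric] flip: ennreal_mult)
    finally show "ennreal (1 / E) \<le> (\<Sum>i. diam_pow s (U i))" by simp
  qed
  also have "\<dots> \<le> hausdorff_measure s X"
    unfolding hausdorff_measure_def by (rule SUP_upper) (simp add: \<delta>_def)
  finally show ?thesis using E by (auto simp: ennreal_eq_0_iff)
qed

section \<open>Hausdorff dimension of the zero set\<close>

definition zeros :: "(nat \<Rightarrow> bool) \<Rightarrow> real set" where
  "zeros b = {x \<in> {0..1}. takagi b x = 0}"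

definition block_count :: "(nat \<Rightarrow> bool) \<Rightarrow> nat \<Rightarrow> nat \<Rightarrow> nat" where
  "block_count b a k = card {l. l < k \<and> splitting_block b (a + 4 * l)}"

lemma block_count_0 [simp]: "block_count b a 0 = 0"
  by (simp add: block_count_def)

text \<open>
  Counting from the end, as the tree of pairs grows; the recursion from the front,
  which matches the recursion on words, is \<open>block_count_Suc_front\<close>.
\<close>
lemma block_count_Suc:
  "block_count b a (Suc k) = block_count b a k + of_bool (splitting_block b (a + 4 * k))"
proof -
  have "{l. l < Suc k \<and> splitting_block b (a + 4 * l)}
      = {l. l < k \<and> splitting_block b (a + 4 * l)} \<union> (if splitting_block b (a + 4 * k) then {k} else {})"
    by (auto simp: less_Suc_eq)
  then show ?thesis by (auto simp: block_count_def)
qed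

text \<open>
  The node with number \<open>c\<close> at depth \<open>k\<close> of the tree of pairs that a selection \<open>ch\<close> of children
  generates. A binary digit of \<open>c\<close> is consumed only at the depths at which the pair splits.
\<close>
primrec descendant_pair ::
  "(nat \<Rightarrow> nat \<times> nat \<Rightarrow> bool \<Rightarrow> nat \<times> nat) \<Rightarrow> (nat \<Rightarrow> bool) \<Rightarrow> nat \<times> nat \<Rightarrow> nat \<Rightarrow> nat \<Rightarrow> nat \<times> nat"
where
  "descendant_pair ch split P 0 c = P"
| "descendant_pair ch split P (Suc k) c = (if split k
     then ch k (descendant_pair ch split P k (c div 2)) (odd c)
     else ch k (descendant_pair ch split P k c) True)"

text \<open>
  The pairs that descend from \<open>P\<close> form a tree as in \<open>hausdorff_measure_nonzero_of_branching\<close>,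
  which branches at the splitting blocks. Along a branch the outer values are \<open>\<plusminus> 1\<close>, so the
  function is of size at most \<open>2 / 2 ^ (a + 4 * k)\<close> there and vanishes in the limit.
\<close>
lemma hausdorff_dim_zeros_pos:
  assumes P: "opposite_pair b a P" "\<And>i. i \<in> members P \<Longrightarrow> i < 2 ^ a"
    and \<gamma>: "0 < \<gamma>" and growth: "\<And>k. k0 \<le> k \<Longrightarrow> \<gamma> * real k \<le> real (block_count b a k)"
  shows "0 < hausdorff_dim (zeros b)"
proof -
  define split where "split k = splitting_block b (a + 4 * k)" for k
  have "\<forall>k R. \<exists>c. opposite_pair b (a + 4 * k) R \<longrightarrow>
       (\<forall>e. opposite_pair b (a + 4 * k + 4) (c e) \<and> (\<lambda>i. i div 16) ` members (c e) \<subseteq> members R)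
     \<and> (split k \<longrightarrow> members (c True) \<inter> members (c False) = {})"
    using opposite_pair_children unfolding split_def by blast
  then obtain ch where ch: "\<And>k R. opposite_pair b (a + 4 * k) R \<Longrightarrow>
       (\<forall>e. opposite_pair b (a + 4 * k + 4) (ch k R e) \<and> (\<lambda>i. i div 16) ` members (ch k R e) \<subseteq> members R)
     \<and> (split k \<longrightarrow> members (ch k R True) \<inter> members (ch k R False) = {})"
    by metis
  define R where "R = descendant_pair ch split P"
  have R_Suc: "R (Suc k) c = (if split k then ch k (R k (c div 2)) (odd c) else ch k (R k c) True)" for k c
    by (simp add: R_def)
  have pair: "opposite_pair b (a + 4 * k) (R k c)" for k c
  proof (induction k arbitrary: c)
    case 0 then show ?case using P(1) by (simp add: R_def)
  next
    case (Suc k)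
    have "a + 4 * Suc k = a + 4 * k + 4" by simp
    then show ?case using ch[OF Suc] unfolding R_Suc by (simp only: if_split) blast
  qed
  have D_Suc: "block_count b a (Suc k) = block_count b a k + of_bool (split k)" for k
    unfolding split_def by (rule block_count_Suc)
  have nested: "(\<lambda>i. i div 16) ` members (R (Suc k) c)
      \<subseteq> members (R k (c div 2 ^ (block_count b a (Suc k) - block_count b a k)))" for k c
  proof (cases "split k")
    case True
    then show ?thesis using ch[OF pair[of k "c div 2"]] unfolding D_Suc R_Suc by simp
  next
    case False
    then show ?thesis using ch[OF pair[of k c]] unfolding D_Suc R_Suc by simp
  qed
  have disj: "c < 2 ^ block_count b a k \<Longrightarrow> c' < 2 ^ block_count b a k \<Longrightarrow> c \<noteq> c'
      \<Longrightarrow> members (R k c) \<inter> members (R k c') = {}" for k c c'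
  proof (induction k arbitrary: c c')
    case (Suc k)
    have apart: "members (ch k (R k u) e) \<inter> members (ch k (R k v) e') = {}"
      if "members (R k u) \<inter> members (R k v) = {}" for u v e e'
      using ch[OF pair[of k u]] ch[OF pair[of k v]] that by blast
    show ?case
    proof (cases "split k")
      case True
      show ?thesis
      proof (cases "c div 2 = c' div 2")
        case same: True
        then have "odd c \<noteq> odd c'" using Suc.prems(3) by presburger
        then show ?thesis using ch[OF pair[of k "c div 2"]] True same unfolding R_Suc
          by (cases "odd c"; cases "odd c'") (auto simp: Int_commute)
      next
        case False
        have "c div 2 < 2 ^ block_count b a k" "c' div 2 < 2 ^ block_count b a k"
          using Suc.prems(1,2) True unfolding D_Suc by auto
        then have "members (R k (c div 2)) \<inter> members (R k (c' div 2)) = {}"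
          using Suc.IH False by blast
        then show ?thesis using True apart unfolding R_Suc by simp
      qed
    next
      case False
      have "members (R k c) \<inter> members (R k c') = {}"
        using Suc.IH Suc.prems False unfolding D_Suc by simp
      then show ?thesis using False apart unfolding R_Suc by simp
    qed
  qed simp
  have tendsto: "filterlim (block_count b a) at_top sequentially"
    unfolding filterlim_at_top
  proof
    fix Z
    obtain N where N: "real Z < real N * \<gamma>" using reals_Archimedean3[OF \<gamma>] by blast
    have "Z \<le> block_count b a k" if "max N k0 \<le> k" for k
    proof -
      have "real N * \<gamma> \<le> \<gamma> * real k" using that \<gamma> by (simp add: mult.commute)
      also have "\<dots> \<le> real (block_count b a k)" using growth that by simp
      finally have "real Z \<le> real (block_count b a k)" using N by linarith
      then show ?thesis unfolding of_nat_le_iff .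
    qed
    then show "\<forall>\<^sub>F k in sequentially. Z \<le> block_count b a k"
      unfolding eventually_sequentially by blast
  qed
  have limit: "x \<in> zeros b" if mem: "\<And>k. \<exists>i\<in>members (R k (c k)). x \<in> seg (a + 4 * k) i" for x c
  proof -
    obtain i where i: "i \<in> members P" "x \<in> seg a i"
      using mem[of 0] by (auto simp: R_def)
    have "real (Suc i) \<le> real (2 ^ a)" using P(2)[OF i(1)] unfolding of_nat_le_iff by simp
    then have "real (Suc i) / 2 ^ a \<le> 1" by (simp add: field_simps)
    moreover have "0 \<le> real i / 2 ^ a" by simp
    ultimately have x01: "x \<in> {0..1}"
      using i(2) unfolding seg_def atLeastAtMost_iff by linarith
    have "\<bar>takagi b x\<bar> \<le> 2 * (1/2) ^ k" for k
    proof -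
      obtain i where i: "i \<in> members (R k (c k))" "x \<in> seg (a + 4 * k) i" using mem[of k] by blast
      have "live b (a + 4 * k) i" "\<bar>outer_value b (a + 4 * k) i\<bar> = 1"
        using pair[of k "c k"] i(1) by (auto simp: opposite_pair_def live_value_def members_def)
      then have "\<bar>takagi b x\<bar> \<le> 2 / 2 ^ (a + 4 * k)"
        using takagi_small_on_live[OF _ i(2), of b] unfolding of_int_abs[symmetric] by simp
      also have "\<dots> = 2 * (1/2) ^ (a + 4 * k)" unfolding power_one_over by simp
      also have "\<dots> \<le> 2 * (1/2) ^ k" by (intro mult_left_mono power_decreasing) auto
      finally show ?thesis .
    qed
    moreover have "(\<lambda>k. 2 * (1/2::real) ^ k) \<longlonglongrightarrow> 2 * 0"
      by (intro tendsto_intros LIMSEQ_realpow_zero) auto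
    ultimately have "\<bar>takagi b x\<bar> \<le> 2 * 0" using LIMSEQ_le_const by blast
    then show ?thesis using x01 by (simp add: zeros_def)
  qed
  \<comment> \<open>The division by 4 appears because one block refines the grid by four levels.\<close>
  have "hausdorff_measure s (zeros b) \<noteq> 0" if "0 \<le> s" "s \<le> \<gamma> / 4" for s
  proof (rule hausdorff_measure_nonzero_of_branching[where Q = "\<lambda>k c. members (R k c)"
        and D = "block_count b a" and a = a])
    show "4 * s * real k \<le> real (block_count b a k)" if "k0 \<le> k" for k
    proof -
      have "4 * s * real k \<le> \<gamma> * real k" using \<open>s \<le> \<gamma> / 4\<close> by (intro mult_right_mono) auto
      then show ?thesis using growth[OF that] by linarith
    qed
    show "block_count b a k \<le> block_count b a (Suc k)" for k by (simp add: D_Suc)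
    show "finite (members (R k c))" "members (R k c) \<noteq> {}" for k c by (simp_all add: members_def)
    show "x \<in> zeros b" if "\<And>k. \<exists>i\<in>members (R k (c k)). x \<in> seg (a + 4 * k) i" for x c
      using that by (rule limit)
    show "members (R k c) \<inter> members (R k c') = {}"
      if "c < 2 ^ block_count b a k" "c' < 2 ^ block_count b a k" "c \<noteq> c'" for k c c'
      using that by (rule disj)
  qed (rule block_count_0 nested tendsto \<open>0 \<le> s\<close>)+
  then have "ennreal (\<gamma> / 4) \<le> hausdorff_dim (zeros b)" by (rule hausdorff_dim_ge)
  moreover have "0 < ennreal (\<gamma> / 4)" using \<gamma> by simp
  ultimately show ?thesis by (rule less_le_trans[rotated])
qed

lemma infinite_if_hausdorff_dim_pos: "0 < hausdorff_dim (A :: real set) \<Longrightarrow> infinite A"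
  using hausdorff_dim_countable[OF countable_finite] by fastforce

definition unit_count :: "(nat \<Rightarrow> bool) \<Rightarrow> nat \<Rightarrow> nat" where
  "unit_count b n = card {m. m < 2 ^ n \<and> live b n m \<and> \<bar>outer_value b n m\<bar> = 1}"

text \<open>
  By \<open>zero_at_old_node\<close>, a zero off the dyadic grid lies in infinitely many segments whose
  bisection creates a new zero, and these are live with outer value \<open>\<plusminus> 1\<close>.
\<close>
lemma hausdorff_dim_zeros_le:
  assumes s: "0 < s" and \<kappa>: "0 < \<kappa>" "\<kappa> < 2 powr s"
    and count: "\<And>n. n0 \<le> n \<Longrightarrow> real (unit_count b n) \<le> c * \<kappa> ^ n"
  shows "hausdorff_dim (zeros b) \<le> ennreal s"
proof (rule hausdorff_dim_le)
  define D where "D = (\<Union>N. (\<lambda>j. real j / 2 ^ N) ` {..2 ^ N})"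
  show "hausdorff_measure s (zeros b) = 0"
  proof (rule hausdorff_measure_limsup_eq_0[OF _ s _ \<kappa>])
    show "countable D" unfolding D_def by auto
    show "finite {m. m < 2 ^ n \<and> live b n m \<and> \<bar>outer_value b n m\<bar> = 1}" for n
      by (rule finite_subset[of _ "{..<2 ^ n}"]) auto
    show "real (card {m. m < 2 ^ n \<and> live b n m \<and> \<bar>outer_value b n m\<bar> = 1}) \<le> c * \<kappa> ^ n" if "n0 \<le> n" for n
      using count[OF that] by (simp add: unit_count_def)
    show "\<exists>n\<ge>N. \<exists>m\<in>{m. m < 2 ^ n \<and> live b n m \<and> \<bar>outer_value b n m\<bar> = 1}. x \<in> seg n m"
      if "x \<in> zeros b" "x \<notin> D" for x N
    proof -
      have x: "0 \<le> x" "x \<le> 1" "takagi b x = 0" using that(1) by (auto simp: zeros_def)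
      have "x \<notin> (\<lambda>j. real j / 2 ^ N) ` {..2 ^ N}" using that(2) by (auto simp: D_def)
      then obtain n m where nm: "N \<le> n" "x \<in> seg n m" "node b (Suc n) (Suc (2 * m)) = 0"
        using zero_at_old_node[OF x, of N] by blast
      have "\<bar>outer_value b n m\<bar> = 1" using nm(3) by (simp add: outer_value_def sg_def split: if_splits)
      moreover have "live b n m" by (rule zero_in_live_segment[OF x(3) nm(2)])
      moreover have "m < 2 ^ n"
      proof (rule ccontr)
        assume "\<not> m < 2 ^ n"
        then have "real (2 ^ n) \<le> real m" unfolding of_nat_le_iff by simp
        then have "1 \<le> real m / 2 ^ n" by (simp add: field_simps)
        then have "x = 1" using nm(2) x(2) unfolding seg_def atLeastAtMost_iff by linarith
        then have "x \<in> D" unfolding D_def by (intro UN_I[of 0] image_eqI[of _ _ 1]) auto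
        then show False using that(2) by simp
      qed
      ultimately show ?thesis using nm(1,2) by blast
    qed
  qed
qed (use s in simp)

section \<open>Random words\<close>

text \<open>
  The mean of \<open>F\<close> over random words of length \<open>n\<close> with independent letters, True having
  probability \<open>p\<close>. All probabilities below are reduced to this finite recursion.
\<close>
primrec bernoulli_mean :: "real \<Rightarrow> nat \<Rightarrow> (bool list \<Rightarrow> real) \<Rightarrow> real" where
  "bernoulli_mean p 0 F = F []"
| "bernoulli_mean p (Suc n) F = p * bernoulli_mean p n (\<lambda>xs. F (True # xs))
     + (1 - p) * bernoulli_mean p n (\<lambda>xs. F (False # xs))"

lemma bernoulli_mean_eq_sum:
  "bernoulli_mean p n F = (\<Sum>xs | length xs = n. (\<Prod>i<n. if xs ! i then p else 1 - p) * F xs)"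
proof (induction n arbitrary: F)
  case (Suc n)
  have fin: "finite {xs :: bool list. length xs = n}"
    using finite_lists_length_eq[of "UNIV :: bool set" n] by simp
  have "{xs :: bool list. length xs = Suc n}
      = (#) True ` {xs. length xs = n} \<union> (#) False ` {xs. length xs = n}"
    by (auto simp: length_Suc_conv image_iff)
  then have "(\<Sum>xs | length xs = Suc n. (\<Prod>i<Suc n. if xs ! i then p else 1 - p) * F xs)
      = (\<Sum>xs\<in>(#) True ` {xs. length xs = n}. (\<Prod>i<Suc n. if xs ! i then p else 1 - p) * F xs)
      + (\<Sum>xs\<in>(#) False ` {xs. length xs = n}. (\<Prod>i<Suc n. if xs ! i then p else 1 - p) * F xs)"
    using fin by (simp only:) (intro sum.union_disjoint; auto)
  also have "\<dots> = bernoulli_mean p (Suc n) F"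
    by (simp add: Suc sum.reindex prod.lessThan_Suc_shift sum_distrib_left mult.assoc del: prod.lessThan_Suc)
  finally show ?case by simp
qed simp

lemma bernoulli_mean_mono:
  assumes "0 \<le> p" "p \<le> 1" "\<And>xs. length xs = n \<Longrightarrow> F xs \<le> G xs"
  shows "bernoulli_mean p n F \<le> bernoulli_mean p n G"
  unfolding bernoulli_mean_eq_sum using assms
  by (intro sum_mono mult_left_mono prod_nonneg) auto

lemma bernoulli_mean_cmult: "bernoulli_mean p n (\<lambda>xs. c * F xs) = c * bernoulli_mean p n F"
  unfolding bernoulli_mean_eq_sum by (simp add: sum_distrib_left mult_ac)

lemma bernoulli_mean_const: "bernoulli_mean p n (\<lambda>_. c) = c"
  by (induction n) (simp_all add: algebra_simps)

lemma bernoulli_mean_append: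
  "bernoulli_mean p (Suc n) F
     = bernoulli_mean p n (\<lambda>xs. p * F (xs @ [True]) + (1 - p) * F (xs @ [False]))"
proof (induction n arbitrary: F)
  case (Suc n)
  show ?case
    by (subst bernoulli_mean.simps(2), subst (1 2) Suc.IH) simp
qed simp

lemma bernoulli_mean_Not: "bernoulli_mean p n (\<lambda>xs. F (map Not xs)) = bernoulli_mean (1 - p) n F"
proof (induction n arbitrary: F)
  case (Suc n)
  show ?case using Suc[of "\<lambda>xs. F (True # xs)"] Suc[of "\<lambda>xs. F (False # xs)"] by simp
qed simp

definition word :: "(nat \<Rightarrow> bool) \<Rightarrow> nat \<Rightarrow> bool list" where
  "word b n = map b [0..<n]"

lemma word_0 [simp]: "word b 0 = []"
  and word_Suc: "word b (Suc n) = b 0 # word (\<lambda>i. b (Suc i)) n"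
  by (simp_all add: word_def upt_conv_Cons map_Suc_upt[symmetric] del: upt_Suc)

lemma length_word [simp]: "length (word b n) = n"
  by (simp add: word_def)

lemma word_eq_iff: "length xs = n \<Longrightarrow> word b n = xs \<longleftrightarrow> (\<forall>i<n. b i = xs ! i)"
  by (auto simp: word_def list_eq_iff_nth_eq)

lemma finite_bool_lists: "finite {xs :: bool list. length xs = n \<and> Q xs}"
  using finite_lists_length_eq[of "UNIV :: bool set" n] by (rule finite_subset[rotated]) auto

locale bernoulli_signs = prob_space M for M :: "'a measure" +
  fixes \<omega> :: "nat \<Rightarrow> 'a \<Rightarrow> real" and p :: real
  assumes p: "0 < p" "p < 1"
    and indep: "indep_vars (\<lambda>_. borel) \<omega> UNIV"
    and prob_one: "\<And>n. prob {w \<in> space M. \<omega> n w = 1} = p"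
begin

definition signs :: "'a \<Rightarrow> nat \<Rightarrow> bool" where
  "signs w n \<longleftrightarrow> \<omega> n w = 1"

lemma measurable_omega [measurable]: "\<omega> n \<in> borel_measurable M"
  using indep by (auto simp: indep_vars_def)

lemma measurable_signs [measurable]: "Measurable.pred M (\<lambda>w. signs w n)"
  unfolding signs_def by measurable

lemma events_word: "{w \<in> space M. Q (word (\<lambda>i. signs w (m + i)) n)} \<in> events"
proof -
  have "{w \<in> space M. Q (word (\<lambda>i. signs w (m + i)) n)}
     = (\<Union>xs\<in>{xs. length xs = n \<and> Q xs}. {w \<in> space M. word (\<lambda>i. signs w (m + i)) n = xs})"
    by auto
  also have "\<dots> = (\<Union>xs\<in>{xs. length xs = n \<and> Q xs}. {w \<in> space M. \<forall>i<n. signs w (m + i) = xs ! i})"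
    by (intro SUP_cong refl Collect_cong conj_cong word_eq_iff) simp
  also have "\<dots> \<in> events"
    by (intro sets.finite_UN finite_bool_lists) measurable
  finally show ?thesis .
qed

lemma prob_word_eq:
  assumes "length xs = n"
  shows "prob {w \<in> space M. word (\<lambda>i. signs w (m + i)) n = xs} = (\<Prod>i<n. if xs ! i then p else 1 - p)"
proof (cases "n = 0")
  case True
  then show ?thesis using assms by (simp add: prob_space)
next
  case False
  define J where "J = (\<lambda>i. m + i) ` {..<n}"
  define A :: "nat \<Rightarrow> real set" where "A j = (if xs ! (j - m) then {1} else - {1})" for j
  have J: "J \<noteq> {}" "finite J" using False by (auto simp: J_def)
  have P: "prob (\<omega> j -` A j \<inter> space M) = (if xs ! (j - m) then p else 1 - p)" for j
  proof -
    have 1: "\<omega> j -` {1} \<inter> space M = {w \<in> space M. \<omega> j w = 1}" by auto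
    have ev: "{w \<in> space M. \<omega> j w = 1} \<in> events" by measurable
    have 2: "\<omega> j -` (- {1}) \<inter> space M = space M - {w \<in> space M. \<omega> j w = 1}" by auto
    show ?thesis
      unfolding A_def using prob_one[of j] prob_compl[OF ev] by (simp add: 1 2)
  qed
  have "{w \<in> space M. word (\<lambda>i. signs w (m + i)) n = xs} = (\<Inter>j\<in>J. \<omega> j -` A j \<inter> space M)"
    using False unfolding word_eq_iff[OF assms]
    by (auto simp: J_def A_def signs_def split: if_splits)
  also have "prob \<dots> = (\<Prod>j\<in>J. prob (\<omega> j -` A j \<inter> space M))"
    using indep_vars_subset[OF indep, of J] J by (intro indep_varsD_finite) (auto simp: A_def)
  also have "\<dots> = (\<Prod>i<n. if xs ! i then p else 1 - p)"
    unfolding P J_def by (subst prod.reindex) (auto simp: inj_on_def)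
  finally show ?thesis .
qed

lemma prob_word:
  "prob {w \<in> space M. Q (word (\<lambda>i. signs w (m + i)) n)} = bernoulli_mean p n (\<lambda>xs. of_bool (Q xs))"
proof -
  define I where "I = {xs :: bool list. length xs = n \<and> Q xs}"
  have fin: "finite {xs :: bool list. length xs = n}" using finite_bool_lists[of n "\<lambda>_. True"] by simp
  have "finite I" unfolding I_def by (rule finite_bool_lists)
  have "{w \<in> space M. Q (word (\<lambda>i. signs w (m + i)) n)}
     = (\<Union>xs\<in>I. {w \<in> space M. word (\<lambda>i. signs w (m + i)) n = xs})"
    by (auto simp: I_def)
  also have "prob \<dots> = (\<Sum>xs\<in>I. prob {w \<in> space M. word (\<lambda>i. signs w (m + i)) n = xs})"
    using \<open>finite I\<close> events_word
    by (intro finite_measure_finite_Union) (auto simp: disjoint_family_on_def)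
  also have "\<dots> = (\<Sum>xs\<in>I. (\<Prod>i<n. if xs ! i then p else 1 - p) * of_bool (Q xs))"
    by (intro sum.cong) (auto simp: I_def prob_word_eq)
  also have "\<dots> = bernoulli_mean p n (\<lambda>xs. of_bool (Q xs))"
    unfolding bernoulli_mean_eq_sum using fin by (intro sum.mono_neutral_left) (auto simp: I_def)
  finally show ?thesis .
qed

text \<open>
  The first Borel-Cantelli lemma for events that depend on finitely many signs.
\<close>
lemma AE_eventually_not_word:
  assumes "summable (\<lambda>k. bernoulli_mean p (l k) (\<lambda>xs. of_bool (Q k xs)))"
  shows "AE w in M. \<forall>\<^sub>F k in sequentially. \<not> Q k (word (\<lambda>i. signs w (m + i)) (l k))"
proof -
  have "AE w in M. \<forall>\<^sub>F k in sequentially. w \<in> space M - {w \<in> space M. Q k (word (\<lambda>i. signs w (m + i)) (l k))}"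
    using assms by (intro borel_cantelli_AE1 events_word) (simp_all add: prob_word less_top[symmetric])
  then show ?thesis by (auto elim!: AE_mp intro!: AE_I2 elim: eventually_mono)
qed

end

section \<open>Frequency of splitting blocks\<close>

fun block_total :: "bool list \<Rightarrow> nat" where
  "block_total (x1 # x2 # x3 # x4 # xs) = of_bool (\<not> x1 \<and> x2 \<and> x3 \<and> \<not> x4) + block_total xs"
| "block_total _ = 0"

text \<open>
  A block is the splitting one with probability \<open>(p * (1 - p))\<^sup>2\<close>, and it then contributes the
  factor 1/2.
\<close>
lemma bernoulli_mean_block_total:
  "bernoulli_mean p (4 * k) (\<lambda>xs. (1/2) ^ block_total xs) = (1 - (p * (1 - p))\<^sup>2 / 2) ^ k"
proof (induction k)
  case (Suc k)
  define N where "N = 4 * k"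
  define B where "B = bernoulli_mean p N (\<lambda>xs. (1/2) ^ block_total xs)"
  have half: "bernoulli_mean p N (\<lambda>xs. (1/2) * (1/2) ^ block_total xs) = (1/2) * B"
    unfolding B_def by (rule bernoulli_mean_cmult)
  have "4 * Suc k = Suc (Suc (Suc (Suc N)))" by (simp add: N_def)
  then have "bernoulli_mean p (4 * Suc k) (\<lambda>xs. (1/2) ^ block_total xs)
      = (1 - (p * (1 - p))\<^sup>2 / 2) * B"
    using half by (simp only: bernoulli_mean.simps block_total.simps simp_thms of_bool_eq power_add
        power_0 power_one_right mult_1 B_def[symmetric]) (simp add: field_simps power2_eq_square)
  then show ?case using Suc by (simp add: B_def N_def)
qed simp

section \<open>Gambler's ruin\<close>

fun reaches :: "int \<Rightarrow> bool list \<Rightarrow> bool" where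
  "reaches j [] \<longleftrightarrow> j \<le> 0"
| "reaches j (x # xs) \<longleftrightarrow> j \<le> 0 \<or> reaches (j - sg x) xs"

text \<open>
  First-step analysis: with this recursion the walk fits words, which grow at the front.
\<close>
lemma walk_shift: "walk b (Suc k) = sg (b 0) + walk (\<lambda>i. b (Suc i)) k"
  unfolding walk_def by (rule sum.lessThan_Suc_shift)

lemma reaches_word: "reaches j (word b n) \<longleftrightarrow> (\<exists>k\<le>n. j \<le> walk b k)"
proof (induction n arbitrary: j b)
  case (Suc n)
  have "reaches j (word b (Suc n)) \<longleftrightarrow> j \<le> walk b 0 \<or> (\<exists>k\<le>n. j \<le> walk b (Suc k))"
    unfolding word_Suc reaches.simps Suc walk_shift by (auto simp: algebra_simps)
  also have "\<dots> \<longleftrightarrow> (\<exists>k\<le>Suc n. j \<le> walk b k)"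
  proof
    assume "\<exists>k\<le>Suc n. j \<le> walk b k"
    then obtain k where k: "k \<le> Suc n" "j \<le> walk b k" by blast
    show "j \<le> walk b 0 \<or> (\<exists>k\<le>n. j \<le> walk b (Suc k))"
    proof (cases k)
      case 0 then show ?thesis using k by simp
    next
      case (Suc l) then show ?thesis using k by blast
    qed
  qed (auto simp del: walk_Suc walk_0)
  finally show ?case .
qed simp

definition reach_prob :: "real \<Rightarrow> nat \<Rightarrow> int \<Rightarrow> real" where
  "reach_prob p n j = bernoulli_mean p n (\<lambda>xs. of_bool (reaches j xs))"

lemma reach_prob_nonpos: "j \<le> 0 \<Longrightarrow> reach_prob p n j = 1"
proof -
  assume "j \<le> 0"
  then have "reaches j xs" for xs by (cases xs) auto
  then show ?thesis by (simp add: reach_prob_def bernoulli_mean_const)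
qed

lemma reach_prob_0: "0 < j \<Longrightarrow> reach_prob p 0 j = 0"
  by (simp add: reach_prob_def)

lemma reach_prob_Suc:
  "0 < j \<Longrightarrow> reach_prob p (Suc n) j = p * reach_prob p n (j - 1) + (1 - p) * reach_prob p n (j + 1)"
  by (simp add: reach_prob_def)

context
  fixes p :: real assumes p: "0 < p" "p < 1"
begin

lemma reach_prob_bounds: "0 \<le> reach_prob p n j" "reach_prob p n j \<le> 1"
proof -
  have "bernoulli_mean p n (\<lambda>_. 0) \<le> reach_prob p n j" "reach_prob p n j \<le> bernoulli_mean p n (\<lambda>_. 1)"
    unfolding reach_prob_def using p by (intro bernoulli_mean_mono; simp)+
  then show "0 \<le> reach_prob p n j" "reach_prob p n j \<le> 1" by (simp_all only: bernoulli_mean_const)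
qed

lemma reach_prob_le_Suc: "reach_prob p n j \<le> reach_prob p (Suc n) j"
proof (induction n arbitrary: j)
  case 0
  show ?case
    using reach_prob_nonpos[of j p] reach_prob_0[of j p] reach_prob_bounds(1)[of "Suc 0" j] by (cases "j \<le> 0") auto
next
  case (Suc n)
  show ?case
  proof (cases "j \<le> 0")
    case False
    then have "0 < j" by simp
    show ?thesis
      unfolding reach_prob_Suc[OF \<open>0 < j\<close>, of p "Suc n"] reach_prob_Suc[OF \<open>0 < j\<close>, of p n]
      using p by (intro add_mono mult_left_mono Suc) auto
  qed (simp add: reach_prob_nonpos)
qed

text \<open>
  The right-hand side solves the recursion of \<open>reach_prob_Suc\<close> and dominates the initial values.
\<close>
lemma reach_prob_le_ratio_power: "reach_prob p n (int j) \<le> (p / (1 - p)) ^ j"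
proof (induction n arbitrary: j)
  case 0
  show ?case using p by (cases "j = 0") (simp_all add: reach_prob_nonpos reach_prob_0)
next
  case (Suc n)
  show ?case
  proof (cases j)
    case 0 then show ?thesis by (simp add: reach_prob_nonpos)
  next
    case (Suc i)
    define r where "r = p / (1 - p)"
    have r: "p = (1 - p) * r" using p by (simp add: r_def)
    have "reach_prob p (Suc n) (int j) = p * reach_prob p n (int i) + (1 - p) * reach_prob p n (int (Suc (Suc i)))"
      using reach_prob_Suc[of "int j" p n] Suc by (simp add: add.commute)
    also have "\<dots> \<le> p * r ^ i + (1 - p) * r ^ Suc (Suc i)"
      using p unfolding r_def by (intro add_mono mult_left_mono Suc.IH) auto
    also have "(1 - p) * r ^ Suc (Suc i) = ((1 - p) * r) * r ^ Suc i" by simp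
    also have "\<dots> = p * r ^ Suc i" by (simp only: r[symmetric])
    also have "p * r ^ i + p * r ^ Suc i = ((1 - p) * r) * r ^ i + p * r ^ Suc i" by (simp only: r[symmetric])
    also have "\<dots> = r ^ j" by (simp add: Suc algebra_simps)
    finally show ?thesis by (simp add: r_def)
  qed
qed

text \<open>
  Gambler's ruin. The limits \<open>u j\<close> satisfy \<open>u j = p * u (j - 1) + (1 - p) * u (j + 1)\<close> and
  \<open>u 0 = 1\<close>, so their differences form a geometric sequence of ratio \<open>r = p / (1 - p)\<close>. Since
  \<open>u\<close> is nonnegative, the sum of these differences is at most 1, which bounds
  \<open>d = 1 - u 1\<close> from above; the bound from below is \<open>reach_prob_le_ratio_power\<close>.
\<close>
lemma reach_prob_limit: "(\<lambda>n. reach_prob p n 1) \<longlonglongrightarrow> min 1 (p / (1 - p))"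
proof -
  define r where "r = p / (1 - p)"
  have r: "0 < r" "p = (1 - p) * r" using p by (simp_all add: r_def)
  have "convergent (\<lambda>n. reach_prob p n j)" for j
  proof (rule Bseq_mono_convergent)
    show "Bseq (\<lambda>n. reach_prob p n j)" using reach_prob_bounds by (intro BseqI'[where K = 1]) auto
    show "\<forall>m. \<forall>n\<ge>m. reach_prob p m j \<le> reach_prob p n j"
      using lift_Suc_mono_le[of "\<lambda>n. reach_prob p n j", OF reach_prob_le_Suc] by blast
  qed
  then have "\<forall>j. \<exists>l. (\<lambda>n. reach_prob p n j) \<longlonglongrightarrow> l" by (simp add: convergent_def)
  then obtain u where u: "\<And>j. (\<lambda>n. reach_prob p n j) \<longlonglongrightarrow> u j" by metis
  have u0: "u 0 = 1" using u[of 0] LIMSEQ_unique[OF _ tendsto_const] by (simp add: reach_prob_nonpos) blast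
  have ubound: "0 \<le> u j" for j
    by (rule LIMSEQ_le_const[OF u]) (use reach_prob_bounds in auto)
  have harmonic: "u j = p * u (j - 1) + (1 - p) * u (j + 1)" if "0 < j" for j
  proof (rule LIMSEQ_unique[OF LIMSEQ_Suc[OF u]])
    show "(\<lambda>n. reach_prob p (Suc n) j) \<longlonglongrightarrow> p * u (j - 1) + (1 - p) * u (j + 1)"
      unfolding reach_prob_Suc[OF that] by (intro tendsto_intros u)
  qed
  have u_le: "u 1 \<le> min 1 r"
  proof -
    have "u 1 \<le> 1" by (rule LIMSEQ_le_const2[OF u]) (use reach_prob_bounds in auto)
    moreover have "u 1 \<le> r"
      by (rule LIMSEQ_le_const2[OF u]) (use reach_prob_le_ratio_power[of _ 1] in \<open>auto simp: r_def\<close>)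
    ultimately show ?thesis by simp
  qed
  define d where "d = 1 - u 1"
  have step: "u (int j) - u (int (Suc j)) = r ^ j * d" for j
  proof (induction j)
    case 0 then show ?case by (simp add: u0 d_def)
  next
    case (Suc j)
    have "u (int (Suc j)) = p * u (int j) + (1 - p) * u (int (Suc (Suc j)))"
      using harmonic[of "int (Suc j)"] by (simp add: add.commute)
    then have "(1 - p) * (u (int (Suc j)) - u (int (Suc (Suc j)))) = p * (u (int j) - u (int (Suc j)))"
      by (simp add: algebra_simps)
    also have "\<dots> = (1 - p) * r * (r ^ j * d)" by (simp only: Suc r(2)[symmetric])
    finally have "(1 - p) * (u (int (Suc j)) - u (int (Suc (Suc j)))) = (1 - p) * (r ^ Suc j * d)"
      by (simp add: mult_ac)
    then show ?case using p by simp
  qed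
  have "1 - u (int j) = d * (\<Sum>i<j. r ^ i)" for j
  proof (induction j)
    case (Suc j) then show ?case using step[of j] by (simp add: algebra_simps)
  qed (simp add: u0)
  then have sum_le: "d * (\<Sum>i<j. r ^ i) \<le> 1" for j
    using ubound[of "int j"] by (metis diff_ge_0_iff_ge diff_add_cancel le_add_same_cancel2 add.commute)
  have "min 1 r \<le> u 1"
  proof (cases "r < 1")
    case True
    \<comment> \<open>The infinite geometric series gives \<open>d \<le> 1 - r\<close>.\<close>
    have "d * ((1 - r ^ j) / (1 - r)) \<le> 1" for j
      using sum_le[of j] True by (simp add: sum_gp_strict)
    moreover have "(\<lambda>j. d * ((1 - r ^ j) / (1 - r))) \<longlonglongrightarrow> d * ((1 - 0) / (1 - r))"
      using r True by (intro tendsto_intros LIMSEQ_realpow_zero) auto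
    ultimately have "d * ((1 - 0) / (1 - r)) \<le> 1" using LIMSEQ_le_const2 by blast
    then have "d \<le> 1 - r" using True by (simp add: field_simps)
    then show ?thesis by (simp add: d_def)
  next
    case False
    have "\<not> 0 < d"
    proof
      assume "0 < d"
      then obtain n where n: "1 < real n * d" using reals_Archimedean3 by blast
      have "real n = (\<Sum>i<n. 1)" by simp
      also have "\<dots> \<le> (\<Sum>i<n. r ^ i)" using False by (intro sum_mono one_le_power) auto
      finally have "d * real n \<le> 1" using sum_le[of n] \<open>0 < d\<close> by (meson mult_left_mono less_imp_le order_trans)
      then show False using n by (simp add: mult.commute)
    qed
    then show ?thesis by (simp add: d_def)
  qed
  then have "u 1 = min 1 (p / (1 - p))" using u_le unfolding r_def by linarith
  then show ?thesis using u[of 1] by simp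
qed

end

definition total :: "bool list \<Rightarrow> int" where
  "total xs = sum_list (map sg xs)"

lemma total_word: "total (word b n) = walk b n"
  by (induction n arbitrary: b) (simp_all add: total_def word_Suc walk_shift del: walk_Suc)

text \<open>
  The exponential moment of the endpoint of the walk.
\<close>
lemma bernoulli_mean_total:
  assumes "\<theta> \<noteq> (0 :: real)"
  shows "bernoulli_mean p n (\<lambda>xs. \<theta> powi total xs) = (p * \<theta> + (1 - p) / \<theta>) ^ n"
proof (induction n)
  case (Suc n)
  have "\<theta> powi total (x # xs) = \<theta> powi sg x * \<theta> powi total xs" for x xs
    using assms by (simp add: total_def power_int_add)
  then show ?case
    by (simp add: bernoulli_mean_cmult Suc power_int_minus algebra_simps divide_inverse)
qed (simp add: total_def)

section \<open>The golden ratio weights\<close>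

text \<open>
  For equal probabilities, an eigenfunction of the mean evolution of the outer values under
  bisection. With \<open>r = sqrt (sqrt 5 - 2)\<close>, the ansatz \<open>r ^ s\<close> for \<open>s \<ge> 1\<close> forces the eigenvalue
  \<open>(r + 1 / r) / 2\<close>, and the two boundary equations at the values 1 and 0 determine \<open>r\<close> and the
  weight \<open>3 - sqrt 5 = 1 - r\<^sup>2\<close> of the value 0. The eigenvalue is \<open>golden_growth\<close>, the square
  root of the golden ratio.
\<close>
definition value_weight :: "int \<Rightarrow> real" where
  "value_weight s = (if s = 0 then 3 - sqrt 5 else sqrt (sqrt 5 - 2) ^ nat \<bar>s\<bar>)"

definition golden_growth :: real where
  "golden_growth = sqrt ((1 + sqrt 5) / 2)"

lemma sqrt5_bounds: "2 < sqrt 5" "sqrt 5 < 3" "sqrt 5 * sqrt 5 = (5::real)"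
  by (auto intro: real_less_rsqrt real_less_lsqrt)

lemma value_weight_nonneg: "0 \<le> value_weight s"
  using sqrt5_bounds by (simp add: value_weight_def)

text \<open>
  The first equation is the eigenvalue equation for outer values of modulus at least 1, the
  second one that for outer value 0.
\<close>
lemma golden_growth_weights:
  defines "r \<equiv> sqrt (sqrt 5 - 2)"
  shows "1 + r\<^sup>2 = 2 * golden_growth * r" "2 * r = golden_growth * (3 - sqrt 5)"
proof -
  have r: "0 \<le> r" "r\<^sup>2 = sqrt 5 - 2" using sqrt5_bounds by (simp_all add: r_def)
  have g: "0 \<le> golden_growth" "golden_growth\<^sup>2 = (1 + sqrt 5) / 2"
    by (simp_all add: golden_growth_def)
  show "1 + r\<^sup>2 = 2 * golden_growth * r"
  proof (rule power2_eq_imp_eq)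
    have "(2 * golden_growth * r)\<^sup>2 = 4 * ((1 + sqrt 5) / 2) * (sqrt 5 - 2)"
      by (simp only: power_mult_distrib g(2) r(2)) simp
    also have "\<dots> = (1 + r\<^sup>2)\<^sup>2"
      unfolding r(2) using sqrt5_bounds(3) by (simp add: power2_eq_square field_simps)
    finally show "(1 + r\<^sup>2)\<^sup>2 = (2 * golden_growth * r)\<^sup>2" by simp
  qed (use r g in auto)
  show "2 * r = golden_growth * (3 - sqrt 5)"
  proof (rule power2_eq_imp_eq)
    have "(golden_growth * (3 - sqrt 5))\<^sup>2 = (1 + sqrt 5) / 2 * (3 - sqrt 5)\<^sup>2"
      by (simp only: power_mult_distrib g(2))
    also have "\<dots> = 4 * (sqrt 5 - 2)"
      using sqrt5_bounds(3) by (simp add: power2_eq_square field_simps)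
    also have "\<dots> = (2 * r)\<^sup>2" by (simp only: power_mult_distrib r(2)) simp
    finally show "(2 * r)\<^sup>2 = (golden_growth * (3 - sqrt 5))\<^sup>2" by simp
  qed (use r g sqrt5_bounds in auto)
qed

text \<open>
  By \<open>node_same_sign\<close>, a segment that is not live has no live descendants. It gets weight 0.
\<close>
definition segment_weight :: "int \<Rightarrow> int \<Rightarrow> real" where
  "segment_weight u v = (if u \<noteq> 0 \<and> v \<noteq> 0 then 0 else value_weight (u + v))"

lemma segment_weight_nonneg: "0 \<le> segment_weight u v"
  by (simp add: segment_weight_def value_weight_nonneg)

lemma segment_weight_swap: "segment_weight v u = segment_weight u v"
  by (simp add: segment_weight_def add.commute)

lemma value_weight_minus: "value_weight (- s) = value_weight s"
  by (simp add: value_weight_def)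

lemma segment_weight_minus: "segment_weight (- u) (- v) = segment_weight u v"
  using value_weight_minus[of "u + v"] by (auto simp: segment_weight_def value_weight_minus)

text \<open>
  The weight of the two halves of a segment with end values \<open>u\<close>, \<open>v\<close> when the next sign is \<open>s\<close>.
\<close>
definition split_weight :: "int \<Rightarrow> int \<Rightarrow> int \<Rightarrow> real" where
  "split_weight u v s = segment_weight (2 * u) (u + v + s) + segment_weight (u + v + s) (2 * v)"

lemma split_weight_one_end:
  assumes "0 < v"
  shows "split_weight 0 v 1 + split_weight 0 v (- 1) \<le> 2 * golden_growth * segment_weight 0 v"
proof -
  define r where "r = sqrt (sqrt 5 - 2)"
  have w: "value_weight s = r ^ nat s" if "0 < s" for s using that by (simp add: value_weight_def r_def)
  have 1: "split_weight 0 v 1 = r ^ nat (v + 1)"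
    using assms by (simp add: split_weight_def segment_weight_def w)
  have eig: "r ^ k + r ^ Suc (Suc k) = 2 * golden_growth * r ^ Suc k" for k
  proof -
    have "r ^ k + r ^ Suc (Suc k) = (1 + r\<^sup>2) * r ^ k" by (simp add: power2_eq_square algebra_simps)
    then show ?thesis unfolding r_def golden_growth_weights(1) by simp
  qed
  show ?thesis
  proof (cases "v = 1")
    case True
    have "split_weight 0 v (- 1) = (3 - sqrt 5) + r\<^sup>2"
      by (simp add: True split_weight_def segment_weight_def value_weight_def r_def eval_nat_numeral)
    moreover have "r\<^sup>2 = sqrt 5 - 2" using sqrt5_bounds by (simp add: r_def)
    ultimately have "split_weight 0 v 1 + split_weight 0 v (- 1) = 1 + r\<^sup>2"
      unfolding 1 by (simp add: True)
    then show ?thesis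
      unfolding r_def golden_growth_weights(1) by (simp add: True segment_weight_def value_weight_def)
  next
    case False
    then obtain k where k: "v = int (Suc (Suc k))"
      using assms by (metis One_nat_def Suc_pred' gr0I nat_0_iff not_le of_nat_1 pos_int_cases zero_less_imp_eq_int)
    have "split_weight 0 v (- 1) = r ^ nat (v - 1)"
      using assms False by (simp add: split_weight_def segment_weight_def w)
    moreover have "nat (v - 1) = Suc k" "nat (v + 1) = Suc (Suc (Suc k))" "nat v = Suc (Suc k)"
      by (simp_all add: k)
    ultimately have "split_weight 0 v 1 + split_weight 0 v (- 1) = 2 * golden_growth * r ^ nat v"
      unfolding 1 using eig[of "Suc k"] by simp
    then show ?thesis using assms by (simp add: segment_weight_def w)
  qed
qed

text \<open>
  The mean evolution, written as a sum over both signs, which doubles the eigenvalue. For end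
  values of the same sign, both nonzero, the middle value is nonzero as well, so that no weight
  is created out of nothing.
\<close>
lemma split_weight_le:
  assumes "(0 \<le> u \<and> 0 \<le> v) \<or> (u \<le> 0 \<and> v \<le> 0)"
  shows "split_weight u v 1 + split_weight u v (- 1) \<le> 2 * golden_growth * segment_weight u v"
proof -
  have swap: "split_weight v u s = split_weight u v s" for u v s
    unfolding split_weight_def
    using segment_weight_swap[of "2 * v" "u + v + s"] segment_weight_swap[of "u + v + s" "2 * u"]
    by (simp add: add.commute[of v u] add.commute)
  have minus: "split_weight (- u) (- v) (- s) = split_weight u v s" for u v s
    using segment_weight_minus[of "2 * u" "u + v + s"] segment_weight_minus[of "u + v + s" "2 * v"]
    by (simp add: split_weight_def)
  have pos: "split_weight 0 v 1 + split_weight 0 v (- 1) \<le> 2 * golden_growth * segment_weight 0 v" if "v \<noteq> 0" for v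
  proof (cases "0 < v")
    case False
    then have "0 < - v" using that by simp
    from split_weight_one_end[OF this] show ?thesis
      using minus[of 0 v 1] minus[of 0 v "- 1"] segment_weight_minus[of 0 v] by simp
  qed (rule split_weight_one_end)
  consider "u = 0" "v = 0" | "u = 0" "v \<noteq> 0" | "u \<noteq> 0" "v = 0" | "u \<noteq> 0" "v \<noteq> 0" by blast
  then show ?thesis
  proof cases
    case 1
    then show ?thesis using golden_growth_weights(2)
      by (simp add: split_weight_def segment_weight_def value_weight_def)
  next
    case 2
    then show ?thesis using pos by simp
  next
    case 3
    then show ?thesis using pos[of u] swap[of u 0] segment_weight_swap[of 0 u] by simp
  next
    case 4
    then have "u + v + 1 \<noteq> 0" "u + v + - 1 \<noteq> 0" using assms by linarith+
    then show ?thesis using 4 by (simp add: split_weight_def segment_weight_def)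
  qed
qed

definition word_weight :: "bool list \<Rightarrow> real" where
  "word_weight xs = (\<Sum>m<2 ^ length xs. segment_weight
     (node (\<lambda>i. xs ! i) (length xs) m) (node (\<lambda>i. xs ! i) (length xs) (Suc m)))"

lemma word_weight_append:
  assumes "length xs = n"
  shows "word_weight (xs @ [c]) = (\<Sum>m<2 ^ n. split_weight
     (node (\<lambda>i. xs ! i) n m) (node (\<lambda>i. xs ! i) n (Suc m)) (sg c))"
proof -
  let ?ys = "xs @ [c]"
  have eq: "node (\<lambda>i. ?ys ! i) n m = node (\<lambda>i. xs ! i) n m" for m
    using assms by (intro node_cong) (simp add: nth_append)
  have c: "?ys ! n = c" using assms by (simp add: nth_append)
  define h where "h m = segment_weight (node (\<lambda>i. ?ys ! i) (Suc n) m) (node (\<lambda>i. ?ys ! i) (Suc n) (Suc m))" for m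
  have "word_weight ?ys = (\<Sum>m<2 * 2 ^ n. h m)"
    unfolding word_weight_def h_def using assms by simp
  also have "\<dots> = (\<Sum>m<2 ^ n. h (2 * m) + h (Suc (2 * m)))"
    using sum.nat_group[of h 2 "2 ^ n"] by (simp add: mult.commute numeral_2_eq_2)
  also have "\<dots> = (\<Sum>m<2 ^ n. split_weight
     (node (\<lambda>i. xs ! i) n m) (node (\<lambda>i. xs ! i) n (Suc m)) (sg c))"
    unfolding h_def node_even node_odd node_even_Suc split_weight_def c eq by simp
  finally show ?thesis .
qed

text \<open>
  The mean total weight grows at most by the factor \<open>golden_growth\<close> per level. The factor
  \<open>3 - sqrt 5\<close> is the weight of the initial segment, whose end values are both 0.
\<close>
lemma bernoulli_mean_word_weight:
  "bernoulli_mean (1/2) n word_weight \<le> golden_growth ^ n * (3 - sqrt 5)"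
proof (induction n)
  case 0
  then show ?case by (simp add: word_weight_def segment_weight_def value_weight_def)
next
  case (Suc n)
  have g: "0 \<le> golden_growth" by (simp add: golden_growth_def)
  have "bernoulli_mean (1/2) (Suc n) word_weight
      = bernoulli_mean (1/2) n (\<lambda>xs. 1/2 * word_weight (xs @ [True]) + (1 - 1/2) * word_weight (xs @ [False]))"
    by (rule bernoulli_mean_append)
  also have "\<dots> \<le> bernoulli_mean (1/2) n (\<lambda>xs. golden_growth * word_weight xs)"
  proof (rule bernoulli_mean_mono)
    fix xs :: "bool list" assume len: "length xs = n"
    let ?u = "\<lambda>m. node (\<lambda>i. xs ! i) n m"
    have "1/2 * word_weight (xs @ [True]) + (1 - 1/2) * word_weight (xs @ [False])
        = 1/2 * (\<Sum>m<2 ^ n. split_weight (?u m) (?u (Suc m)) 1 + split_weight (?u m) (?u (Suc m)) (- 1))"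
      by (simp add: word_weight_append[OF len] sum.distrib)
    also have "\<dots> \<le> 1/2 * (\<Sum>m<2 ^ n. 2 * golden_growth * segment_weight (?u m) (?u (Suc m)))"
      by (intro mult_left_mono sum_mono split_weight_le node_same_sign) simp
    also have "\<dots> = golden_growth * word_weight xs"
      by (simp add: word_weight_def len sum_distrib_left[symmetric] mult.assoc)
    finally show "1/2 * word_weight (xs @ [True]) + (1 - 1/2) * word_weight (xs @ [False]) \<le> golden_growth * word_weight xs" .
  qed simp_all
  also have "\<dots> = golden_growth * bernoulli_mean (1/2) n word_weight" by (rule bernoulli_mean_cmult)
  also have "\<dots> \<le> golden_growth * (golden_growth ^ n * (3 - sqrt 5))" by (intro mult_left_mono Suc g)
  finally show ?case by simp
qed

lemma unit_count_le_weight: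
  "sqrt (sqrt 5 - 2) * real (unit_count b n) \<le> word_weight (word b n)"
proof -
  let ?K = "{m. m < 2 ^ n \<and> live b n m \<and> \<bar>outer_value b n m\<bar> = 1}"
  have eq: "node (\<lambda>i. word b n ! i) n m = node b n m" for m
    by (intro node_cong) (simp add: word_def)
  have "sqrt (sqrt 5 - 2) * real (unit_count b n) = (\<Sum>m\<in>?K. sqrt (sqrt 5 - 2))"
    by (simp add: unit_count_def)
  also have "\<dots> \<le> (\<Sum>m\<in>?K. segment_weight (node b n m) (node b n (Suc m)))"
  proof (rule sum_mono)
    fix m assume "m \<in> ?K"
    then have "node b n m = 0 \<or> node b n (Suc m) = 0" "\<bar>node b n m + node b n (Suc m)\<bar> = 1"
      by (auto simp: live_def outer_value_def)
    then show "sqrt (sqrt 5 - 2) \<le> segment_weight (node b n m) (node b n (Suc m))"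
      by (auto simp: segment_weight_def value_weight_def)
  qed
  also have "\<dots> \<le> (\<Sum>m<2 ^ n. segment_weight (node b n m) (node b n (Suc m)))"
    by (rule sum_mono2) (auto simp: segment_weight_nonneg)
  also have "\<dots> = word_weight (word b n)"
    by (simp add: word_weight_def eq)
  finally show ?thesis .
qed

lemma block_count_Suc_front:
  "block_count b a (Suc k) = of_bool (splitting_block b a) + block_count b (a + 4) k"
proof (induction k)
  case (Suc k)
  have "a + 4 * Suc k = a + 4 + 4 * k" by simp
  then show ?case using Suc block_count_Suc[of b a "Suc k"] block_count_Suc[of b "a + 4" k]
    by (simp only: add.assoc)
qed (simp add: block_count_Suc)

lemma block_total_word: "block_total (word (\<lambda>i. b (a + i)) (4 * k)) = block_count b a k"
proof (induction k arbitrary: a)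
  case (Suc k)
  have 4: "4 * Suc k = Suc (Suc (Suc (Suc (4 * k))))" by simp
  have 3: "a + 2 = a + Suc (Suc 0)" "a + 3 = a + Suc (Suc (Suc 0))"
    "\<And>i. a + 4 + i = a + Suc (Suc (Suc (Suc i)))" by simp_all
  show ?case
    using Suc[of "a + 4"]
    unfolding 4 word_Suc block_total.simps block_count_Suc_front splitting_block_def 3 by simp
qed simp

section \<open>Almost sure behaviour of the zero set\<close>

lemma summable_bernoulli_mean_of_bool:
  assumes "0 \<le> p" "p \<le> 1" "0 \<le> r" "r < 1"
    and "\<And>k. bernoulli_mean p (l k) (\<lambda>xs. of_bool (Q k xs)) \<le> C * r ^ k"
  shows "summable (\<lambda>k. bernoulli_mean p (l k) (\<lambda>xs. of_bool (Q k xs)))"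
proof (rule summable_comparison_test')
  show "summable (\<lambda>k. C * r ^ k)" using assms by (intro summable_mult summable_geometric) simp
  fix k
  have "bernoulli_mean p (l k) (\<lambda>_. 0) \<le> bernoulli_mean p (l k) (\<lambda>xs. of_bool (Q k xs))"
    using assms by (intro bernoulli_mean_mono) auto
  then have "0 \<le> bernoulli_mean p (l k) (\<lambda>xs. of_bool (Q k xs))" by (simp only: bernoulli_mean_const)
  then show "norm (bernoulli_mean p (l k) (\<lambda>xs. of_bool (Q k xs))) \<le> C * r ^ k" using assms(5)[of k] by simp
qed

context bernoulli_signs
begin

text \<open>
  A Chernoff bound instead of the law of large numbers: having fewer than \<open>\<gamma> * k\<close> splitting
  blocks among \<open>k\<close> has exponentially small probability.
\<close>
lemma AE_block_count_linear:
  "AE w in M. \<exists>\<gamma>>0. \<exists>k0. \<forall>k\<ge>k0. \<gamma> * real k \<le> real (block_count (signs w) a k)"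
proof -
  define \<theta> where "\<theta> = 1 - (p * (1 - p))\<^sup>2 / 2"
  have pq: "0 < p * (1 - p)" "p * (1 - p) < 1" using p mult_strict_mono[of p 1 "1 - p" 1] by simp_all
  then have "(p * (1 - p))\<^sup>2 < 1" by (simp add: power_less_one_iff)
  then have \<theta>: "0 < \<theta>" "\<theta> < 1" using pq by (auto simp: \<theta>_def)
  \<comment> \<open>Chosen such that the weight \<open>2 powr (\<gamma> * k)\<close> of the deviation is compensated by half of the decay of \<open>\<theta> ^ k\<close>.\<close>
  define \<gamma> where "\<gamma> = - log 2 \<theta> / 2"
  have \<gamma>: "0 < \<gamma>" using \<theta> by (simp add: \<gamma>_def)
  have "2 powr (- \<gamma>) = (2 powr log 2 \<theta>) powr (1/2)" unfolding powr_powr by (simp add: \<gamma>_def)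
  also have "\<dots> = sqrt \<theta>" using \<theta> by (simp add: powr_half_sqrt)
  finally have root: "sqrt \<theta> ^ k = 2 powr (- (\<gamma> * real k))" for k
    using powr_power[of 2 "- \<gamma>" k] by (simp add: mult.commute)
  have "bernoulli_mean p (4 * k) (\<lambda>xs. of_bool (real (block_total xs) < \<gamma> * real k)) \<le> 1 * sqrt \<theta> ^ k" for k
  proof -
    have "bernoulli_mean p (4 * k) (\<lambda>xs. of_bool (real (block_total xs) < \<gamma> * real k))
        \<le> bernoulli_mean p (4 * k) (\<lambda>xs. (1 / sqrt \<theta> ^ k) * (1/2) ^ block_total xs)"
    proof (rule bernoulli_mean_mono)
      fix xs :: "bool list"
      have "sqrt \<theta> ^ k \<le> (1/2) ^ block_total xs" if "real (block_total xs) < \<gamma> * real k"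
      proof -
        have "sqrt \<theta> ^ k \<le> 2 powr (- real (block_total xs))"
          unfolding root using that by (intro powr_mono) auto
        also have "\<dots> = (1/2) ^ block_total xs"
          by (simp add: powr_minus powr_realpow power_one_over inverse_eq_divide)
        finally show ?thesis .
      qed
      then show "of_bool (real (block_total xs) < \<gamma> * real k) \<le> (1 / sqrt \<theta> ^ k) * (1/2) ^ block_total xs"
        using \<theta> by (auto simp: of_bool_def divide_simps)
    qed (use p in auto)
    also have "\<dots> = (1 / sqrt \<theta> ^ k) * \<theta> ^ k"
      unfolding bernoulli_mean_cmult bernoulli_mean_block_total \<theta>_def ..
    also have "\<theta> ^ k = sqrt \<theta> ^ k * sqrt \<theta> ^ k"
      using \<theta> by (simp flip: power_mult_distrib)
    finally show ?thesis using \<theta> by simp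
  qed
  then have "summable (\<lambda>k. bernoulli_mean p (4 * k) (\<lambda>xs. of_bool (real (block_total xs) < \<gamma> * real k)))"
    using p \<theta> by (intro summable_bernoulli_mean_of_bool[where r = "sqrt \<theta>" and C = 1]) auto
  from AE_eventually_not_word[OF this, of a]
  show ?thesis
    by eventually_elim
      (use \<gamma> in \<open>auto simp: block_total_word eventually_sequentially not_less intro!: exI[of _ \<gamma>]\<close>)
qed

text \<open>
  Again by exponential moments: \<open>\<theta> powi total xs\<close> equals 1 when the walk is at 0, so the
  probability of that is at most the moment, which decays exponentially for a suitable \<open>\<theta>\<close>.
\<close>
lemma AE_walk_eventually_nonzero:
  assumes "p \<noteq> 1/2"
  shows "AE w in M. \<forall>\<^sub>F n in sequentially. walk (signs w) n \<noteq> 0"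
proof -
  \<comment> \<open>Any value strictly between 1 and \<open>(1 - p) / p\<close> makes the moment less than 1; this is the midpoint.\<close>
  define \<theta> where "\<theta> = 1 / (2 * p)"
  define r where "r = p * \<theta> + (1 - p) / \<theta>"
  have \<theta>: "0 < \<theta>" using p by (simp add: \<theta>_def)
  have "r = 1 - (1 - 2 * p)\<^sup>2 / 2" using p by (simp add: r_def \<theta>_def power2_eq_square field_simps)
  moreover have "0 < (1 - 2 * p)\<^sup>2" using assms by simp
  ultimately have "r < 1" by simp
  have "0 \<le> r" using p \<theta> by (simp add: r_def)
  have "bernoulli_mean p n (\<lambda>xs. of_bool (total xs = 0)) \<le> 1 * r ^ n" for n
  proof -
    have "bernoulli_mean p n (\<lambda>xs. of_bool (total xs = 0)) \<le> bernoulli_mean p n (\<lambda>xs. \<theta> powi total xs)"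
      using p \<theta> by (intro bernoulli_mean_mono) auto
    then show ?thesis using bernoulli_mean_total[of \<theta> p n] \<theta> by (simp add: r_def)
  qed
  then have "summable (\<lambda>n. bernoulli_mean p n (\<lambda>xs. of_bool (total xs = 0)))"
    using p \<open>0 \<le> r\<close> \<open>r < 1\<close> by (intro summable_bernoulli_mean_of_bool[where r = r and C = 1]) auto
  from AE_eventually_not_word[OF this, of 0] show ?thesis by (simp add: total_word)
qed

lemma prob_walk_positive:
  "{w \<in> space M. \<exists>n. 0 < walk (signs w) n} \<in> events"
  "prob {w \<in> space M. \<exists>n. 0 < walk (signs w) n} = min 1 (p / (1 - p))"
proof -
  define A where "A n = {w \<in> space M. reaches 1 (word (\<lambda>i. signs w (0 + i)) n)}" for n
  have A: "A n \<in> events" for n unfolding A_def by (rule events_word)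
  have Aeq: "A n = {w \<in> space M. \<exists>k\<le>n. 0 < walk (signs w) k}" for n
    by (auto simp: A_def reaches_word)
  have un: "(\<Union>n. A n) = {w \<in> space M. \<exists>n. 0 < walk (signs w) n}"
    unfolding Aeq by auto
  show "{w \<in> space M. \<exists>n. 0 < walk (signs w) n} \<in> events"
    unfolding un[symmetric] using A by blast
  have "A n \<subseteq> A (Suc n)" for n unfolding Aeq by (auto intro: le_SucI)
  then have "incseq A" by (rule incseq_SucI)
  then have "(\<lambda>n. prob (A n)) \<longlonglongrightarrow> prob (\<Union>n. A n)"
    using A by (intro finite_Lim_measure_incseq) auto
  moreover have "prob (A n) = reach_prob p n 1" for n
    unfolding A_def reach_prob_def by (rule prob_word)
  ultimately show "prob {w \<in> space M. \<exists>n. 0 < walk (signs w) n} = min 1 (p / (1 - p))"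
    unfolding un using LIMSEQ_unique[OF _ reach_prob_limit[OF p]] by simp
qed

lemma prob_walk_negative:
  "{w \<in> space M. \<exists>n. walk (signs w) n < 0} \<in> events"
  "prob {w \<in> space M. \<exists>n. walk (signs w) n < 0} = min 1 ((1 - p) / p)"
proof -
  define A where "A n = {w \<in> space M. reaches 1 (map Not (word (\<lambda>i. signs w (0 + i)) n))}" for n
  have A: "A n \<in> events" for n unfolding A_def by (rule events_word)
  have Not: "map Not (word b n) = word (\<lambda>i. \<not> b i) n" for b n by (simp add: word_def)
  have Aeq: "A n = {w \<in> space M. \<exists>k\<le>n. walk (signs w) k < 0}" for n
    unfolding A_def Not reaches_word walk_Not by auto
  have un: "(\<Union>n. A n) = {w \<in> space M. \<exists>n. walk (signs w) n < 0}"
    unfolding Aeq by auto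
  show "{w \<in> space M. \<exists>n. walk (signs w) n < 0} \<in> events"
    unfolding un[symmetric] using A by blast
  have "A n \<subseteq> A (Suc n)" for n unfolding Aeq by (auto intro: le_SucI)
  then have "incseq A" by (rule incseq_SucI)
  then have "(\<lambda>n. prob (A n)) \<longlonglongrightarrow> prob (\<Union>n. A n)"
    using A by (intro finite_Lim_measure_incseq) auto
  moreover have "prob (A n) = reach_prob (1 - p) n 1" for n
    using prob_word[of "\<lambda>xs. reaches 1 (map Not xs)" 0 n]
      bernoulli_mean_Not[of p n "\<lambda>xs. of_bool (reaches 1 xs)"]
    unfolding A_def reach_prob_def by (simp only:)
  ultimately show "prob {w \<in> space M. \<exists>n. walk (signs w) n < 0} = min 1 ((1 - p) / p)"
    unfolding un using LIMSEQ_unique[OF _ reach_prob_limit[of "1 - p"]] p by simp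
qed

definition one_sided :: "'a set" where
  "one_sided = {w \<in> space M. (\<forall>n. walk (signs w) n \<le> 0) \<or> (\<forall>n. 0 \<le> walk (signs w) n)}"

text \<open>
  The two one-sided events are disjoint because the first step is nonzero. Of the two
  probabilities, one vanishes in every case, but the sum has a uniform expression.
\<close>
lemma prob_one_sided:
  "one_sided \<in> events" "prob one_sided = 1 - min (p / (1 - p)) ((1 - p) / p)"
proof -
  let ?P = "{w \<in> space M. \<exists>n. 0 < walk (signs w) n}" and ?N = "{w \<in> space M. \<exists>n. walk (signs w) n < 0}"
  have eq: "one_sided = (space M - ?P) \<union> (space M - ?N)"
    unfolding one_sided_def not_less[symmetric] by blast
  have "0 < walk (signs w) 1 \<or> walk (signs w) 1 < 0" for w by (simp add: sg_def)
  then have disj: "(space M - ?P) \<inter> (space M - ?N) = {}" by blast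
  show "one_sided \<in> events" unfolding eq using prob_walk_positive(1) prob_walk_negative(1) by blast
  have "prob one_sided = prob (space M - ?P) + prob (space M - ?N)"
    unfolding eq using prob_walk_positive(1) prob_walk_negative(1) disj
    by (intro finite_measure_Union) auto
  also have "\<dots> = (1 - min 1 (p / (1 - p))) + (1 - min 1 ((1 - p) / p))"
    using prob_compl[OF prob_walk_positive(1)] prob_compl[OF prob_walk_negative(1)]
    by (simp add: prob_walk_positive(2) prob_walk_negative(2))
  also have "\<dots> = 1 - min (p / (1 - p)) ((1 - p) / p)"
  proof (cases "p \<le> 1 - p")
    case True
    then have "p / (1 - p) \<le> 1" "1 \<le> (1 - p) / p" using p by (simp_all add: field_simps)
    then show ?thesis by linarith
  next
    case False
    then have "1 \<le> p / (1 - p)" "(1 - p) / p \<le> 1" using p by (simp_all add: field_simps)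
    then show ?thesis by linarith
  qed
  finally show "prob one_sided = 1 - min (p / (1 - p)) ((1 - p) / p)" .
qed

text \<open>
  A walk that takes both signs produces an opposite pair, and the dimension is positive by the
  linear growth of the number of splitting blocks. A one-sided walk leaves 0 for good, by
  \<open>AE_walk_eventually_nonzero\<close>, or almost surely does not occur, when \<open>p = 1/2\<close>.
\<close>
lemma AE_zeros_dichotomy:
  "AE w in M. (w \<in> one_sided \<longrightarrow> finite (zeros (signs w)))
     \<and> (w \<notin> one_sided \<longrightarrow> 0 < hausdorff_dim (zeros (signs w)))"
proof -
  have "AE w in M. \<forall>a. \<exists>\<gamma>>0. \<exists>k0. \<forall>k\<ge>k0. \<gamma> * real k \<le> real (block_count (signs w) a k)"
    unfolding AE_all_countable by (intro allI AE_block_count_linear)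
  moreover have "AE w in M. w \<in> one_sided \<longrightarrow> (\<forall>\<^sub>F n in sequentially. walk (signs w) n \<noteq> 0)"
  proof (cases "p = 1/2")
    case True
    have "prob one_sided = 0" unfolding prob_one_sided(2) True by simp
    then have "AE w in M. w \<notin> one_sided"
      using prob_eq_0[OF prob_one_sided(1)] by simp
    then show ?thesis by eventually_elim simp
  next
    case False
    from AE_walk_eventually_nonzero[OF this] show ?thesis by eventually_elim simp
  qed
  ultimately show ?thesis using AE_space
  proof eventually_elim
    fix w assume blocks: "\<forall>a. \<exists>\<gamma>>0. \<exists>k0. \<forall>k\<ge>k0. \<gamma> * real k \<le> real (block_count (signs w) a k)"
      and nonzero: "w \<in> one_sided \<longrightarrow> (\<forall>\<^sub>F n in sequentially. walk (signs w) n \<noteq> 0)"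
      and space: "w \<in> space M"
    show "(w \<in> one_sided \<longrightarrow> finite (zeros (signs w)))
     \<and> (w \<notin> one_sided \<longrightarrow> 0 < hausdorff_dim (zeros (signs w)))"
    proof (intro conjI impI)
      assume w: "w \<in> one_sided"
      then obtain N where N: "\<And>n. N \<le> n \<Longrightarrow> walk (signs w) n \<noteq> 0"
        using nonzero unfolding eventually_sequentially by blast
      consider "\<And>n. walk (signs w) n \<le> 0" | "\<And>n. 0 \<le> walk (signs w) n"
        using w by (auto simp: one_sided_def)
      then show "finite (zeros (signs w))"
      proof cases
        case 1
        then show ?thesis unfolding zeros_def
          by (rule finite_zeros_if_walk_stays_below[of _ N]) (use 1 N in \<open>auto simp: order_less_le\<close>)
      next
        case 2
        have "finite {x \<in> {0..1}. takagi (\<lambda>n. \<not> signs w n) x = 0}"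
          by (rule finite_zeros_if_walk_stays_below[of _ N])
            (use 2 N in \<open>auto simp: walk_Not order_less_le\<close>)
        then show ?thesis by (simp add: zeros_def takagi_Not)
      qed
    next
      assume "w \<notin> one_sided"
      then obtain k l where "0 < walk (signs w) k" "walk (signs w) l < 0"
        using space by (auto simp: one_sided_def not_le)
      then obtain n P where P: "opposite_pair (signs w) n P" "\<forall>i\<in>members P. i < 2 ^ n"
        using opposite_pair_if_walk_changes_sign by blast
      obtain \<gamma> k0 where "0 < \<gamma>" "\<And>k. k0 \<le> k \<Longrightarrow> \<gamma> * real k \<le> real (block_count (signs w) n k)"
        using blocks by blast
      then show "0 < hausdorff_dim (zeros (signs w))"
        using P by (intro hausdorff_dim_zeros_pos[of "signs w" n P \<gamma> k0]) auto
    qed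
  qed
qed

text \<open>
  By Markov's inequality and Borel-Cantelli, the total weight is almost surely at most
  \<open>\<kappa> ^ n\<close> from some level on, for every \<open>\<kappa>\<close> beyond the mean growth rate.
\<close>
lemma AE_hausdorff_dim_less_exponent:
  assumes "p = 1/2" and s: "0 < s" "golden_growth < 2 powr s"
  shows "AE w in M. hausdorff_dim (zeros (signs w)) \<le> ennreal s"
proof -
  \<comment> \<open>Any rate strictly between the mean growth of the weight and the reciprocal cost of a segment.\<close>
  define \<kappa> where "\<kappa> = (golden_growth + 2 powr s) / 2"
  have g: "0 < golden_growth" by (auto simp: golden_growth_def intro: add_pos_nonneg)
  have \<kappa>: "golden_growth < \<kappa>" "0 < \<kappa>" "\<kappa> < 2 powr s" using s g by (simp_all add: \<kappa>_def)
  have "bernoulli_mean p n (\<lambda>xs. of_bool (\<kappa> ^ n < word_weight xs)) \<le> (3 - sqrt 5) * (golden_growth / \<kappa>) ^ n" for n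
  proof -
    have nn: "0 \<le> word_weight xs" for xs
      unfolding word_weight_def by (intro sum_nonneg segment_weight_nonneg)
    have "bernoulli_mean p n (\<lambda>xs. of_bool (\<kappa> ^ n < word_weight xs))
        \<le> bernoulli_mean p n (\<lambda>xs. (1 / \<kappa> ^ n) * word_weight xs)"
      using p \<kappa> nn by (intro bernoulli_mean_mono) (auto simp: of_bool_def divide_simps)
    also have "\<dots> \<le> (1 / \<kappa> ^ n) * (golden_growth ^ n * (3 - sqrt 5))"
      unfolding bernoulli_mean_cmult assms(1)
      using \<kappa> by (intro mult_left_mono bernoulli_mean_word_weight) auto
    also have "\<dots> = (3 - sqrt 5) * (golden_growth / \<kappa>) ^ n" by (simp add: power_divide)
    finally show ?thesis .
  qed
  then have "summable (\<lambda>n. bernoulli_mean p n (\<lambda>xs. of_bool (\<kappa> ^ n < word_weight xs)))"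
    using p \<kappa> g by (intro summable_bernoulli_mean_of_bool[where r = "golden_growth / \<kappa>" and C = "3 - sqrt 5"]) auto
  from AE_eventually_not_word[OF this, of 0]
  show ?thesis
  proof eventually_elim
    fix w assume "\<forall>\<^sub>F n in sequentially. \<not> \<kappa> ^ n < word_weight (word (\<lambda>i. signs w (0 + i)) n)"
    then obtain n0 where n0: "\<And>n. n0 \<le> n \<Longrightarrow> word_weight (word (signs w) n) \<le> \<kappa> ^ n"
      by (auto simp: eventually_sequentially not_less)
    define r where "r = sqrt (sqrt 5 - 2)"
    have r: "0 < r" using sqrt5_bounds by (simp add: r_def)
    show "hausdorff_dim (zeros (signs w)) \<le> ennreal s"
    proof (rule hausdorff_dim_zeros_le[OF s(1) \<kappa>(2,3)])
      fix n assume "n0 \<le> n"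
      have "r * real (unit_count (signs w) n) \<le> word_weight (word (signs w) n)"
        unfolding r_def by (rule unit_count_le_weight)
      also have "\<dots> \<le> \<kappa> ^ n" by (rule n0[OF \<open>n0 \<le> n\<close>])
      finally show "real (unit_count (signs w) n) \<le> (1 / r) * \<kappa> ^ n"
        using r by (simp add: field_simps)
    qed
  qed
qed

text \<open>
  The critical exponent \<open>d\<close> is the solution of \<open>2 powr d = golden_growth\<close>. Exponents above it are
  treated one at a time, and countably many of them suffice.
\<close>
lemma AE_hausdorff_dim_le:
  assumes "p = 1/2"
  shows "AE w in M. hausdorff_dim (zeros (signs w)) \<le> ennreal (ln ((1 + sqrt 5) / 2) / ln 4)"
proof -
  define d where "d = ln ((1 + sqrt 5) / 2) / ln 4"
  have "0 \<le> d" unfolding d_def using sqrt5_bounds by (intro divide_nonneg_pos ln_ge_zero) auto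
  have "ln (4::real) = 2 * ln 2" using ln_realpow[of 2 2] by simp
  then have "2 powr d = exp (ln ((1 + sqrt 5) / 2) / 2)" by (simp add: powr_def d_def)
  also have "\<dots> = ((1 + sqrt 5) / 2) powr (1/2)" using sqrt5_bounds by (simp add: powr_def)
  also have "\<dots> = golden_growth" unfolding golden_growth_def by (rule powr_half_sqrt) simp
  finally have d: "2 powr d = golden_growth" .
  have "AE w in M. \<forall>j. hausdorff_dim (zeros (signs w)) \<le> ennreal (d + 1 / real (Suc j))"
    unfolding AE_all_countable
  proof
    fix j
    have pos: "0 < 1 / real (Suc j)" by simp
    show "AE w in M. hausdorff_dim (zeros (signs w)) \<le> ennreal (d + 1 / real (Suc j))"
    proof (rule AE_hausdorff_dim_less_exponent[OF assms])
      show "0 < d + 1 / real (Suc j)" using pos \<open>0 \<le> d\<close> by linarith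
      show "golden_growth < 2 powr (d + 1 / real (Suc j))"
        unfolding d[symmetric] by (rule powr_less_mono) (use pos in auto)
    qed
  qed
  then show ?thesis
  proof eventually_elim
    fix w assume le: "\<forall>j. hausdorff_dim (zeros (signs w)) \<le> ennreal (d + 1 / real (Suc j))"
    have "(\<lambda>j. ennreal (d + 1 / real (Suc j))) \<longlonglongrightarrow> ennreal (d + 0)"
      by (intro tendsto_ennrealI tendsto_intros LIMSEQ_Suc[OF lim_1_over_n])
    then show "hausdorff_dim (zeros (signs w)) \<le> ennreal (ln ((1 + sqrt 5) / 2) / ln 4)"
      using LIMSEQ_le_const le unfolding d_def[symmetric] by fastforce
  qed
qed

end

theorem theorem1p5:
  fixes M :: "'a measure" and \<omega> :: "nat \<Rightarrow> 'a \<Rightarrow> real" and p q :: real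
    and L :: "'a \<Rightarrow> real set"
  assumes "prob_space M"
    and "0 < p" and "p < 1" and "q = 1 - p"
    and "prob_space.indep_vars M (\<lambda>_. borel) \<omega> UNIV"
    and "\<And>n. measure M {w \<in> space M. \<omega> n w = 1} = p"
    and "\<And>n. measure M {w \<in> space M. \<omega> n w = - 1} = 1 - p"
  defines "L \<equiv> (\<lambda>w. level_set (flexible_takagi (\<lambda>n. \<omega> n w)) 0)"
  shows "{w \<in> space M. finite (L w)} \<in> sets (completion M)
      \<and> measure (completion M) {w \<in> space M. finite (L w)} = 1 - min (p / q) (q / p)
      \<and> (AE w in M. infinite (L w) \<longrightarrow> 0 < hausdorff_dim (L w))
      \<and> (p = 1 / 2 \<longrightarrow>
          (AE w in M. hausdorff_dim (L w) \<le> ennreal (ln ((1 + sqrt 5) / 2) / ln 4)))"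
proof -
  interpret prob_space M by fact
  interpret bernoulli_signs M \<omega> p
    by unfold_locales (use assms in auto)
  have "AE w in M. \<forall>n. \<omega> n w = of_int (sg (signs w n))"
    unfolding AE_all_countable
  proof
    fix n
    let ?A = "{w \<in> space M. \<omega> n w = 1}" and ?B = "{w \<in> space M. \<omega> n w = - 1}"
    have ev: "?A \<in> events" "?B \<in> events" by measurable
    have "prob (?A \<union> ?B) = prob ?A + prob ?B" using ev by (intro finite_measure_Union) auto
    also have "\<dots> = 1" using assms(6)[of n] assms(7)[of n] by simp
    finally have "AE w in M. w \<in> ?A \<union> ?B" using ev prob_eq_1[of "?A \<union> ?B"] by blast
    then show "AE w in M. \<omega> n w = of_int (sg (signs w n))"
      by eventually_elim (auto simp: signs_def)
  qed
  then have L: "AE w in M. L w = zeros (signs w)"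
    by eventually_elim (simp add: L_def level_set_def zeros_def takagi_def)
  have fin_iff: "AE w in M. finite (L w) \<longleftrightarrow> w \<in> one_sided"
    using L AE_zeros_dichotomy by eventually_elim (use infinite_if_hausdorff_dim_pos in auto)
  have one: "one_sided \<in> sets (completion M)"
    using prob_one_sided(1) by (rule sets_completionI_sets)
  have fin_iff': "AE w in completion M. finite (L w) \<longleftrightarrow> w \<in> one_sided"
    using fin_iff by (rule AE_completion)
  have ae: "AE w in completion M. (w \<in> one_sided) = (w \<in> {w \<in> space M. finite (L w)})"
    using fin_iff' AE_space by eventually_elim auto
  have ev: "{w \<in> space M. finite (L w)} \<in> sets (completion M)"
  proof (rule completion.in_sets_AE[OF ae])
    show "one_sided \<in> sets (completion M)" by fact
    show "{w \<in> space M. finite (L w)} \<subseteq> space (completion M)" by auto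
  qed
  have "measure (completion M) {w \<in> space M. finite (L w)} = measure (completion M) one_sided"
    by (rule measure_eq_AE[OF ae one ev, symmetric])
  also have "\<dots> = 1 - min (p / q) (q / p)"
    using prob_one_sided assms(4) by (simp add: measure_completion)
  finally have prob: "measure (completion M) {w \<in> space M. finite (L w)} = 1 - min (p / q) (q / p)" .
  have pos: "AE w in M. infinite (L w) \<longrightarrow> 0 < hausdorff_dim (L w)"
    using L fin_iff AE_zeros_dichotomy by eventually_elim auto
  have dim: "AE w in M. hausdorff_dim (L w) \<le> ennreal (ln ((1 + sqrt 5) / 2) / ln 4)" if "p = 1/2"
    using L AE_hausdorff_dim_le[OF that] by eventually_elim simp
  show ?thesis using ev prob pos dim by blast
qed

end
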